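(* Let $q$ be a complex number with $0<|q|<1$. (1) Let $(A_m)_{m\ge 0}$, $(B_m)_{m\ge 0}$, $(C_m)_{m\ge 0}$ be the sequences each satisfying, for $m\ge 3$, the recursion $$X_m=(1+q^{2m-4})X_{m-1}+(q^2+q^{2m-4})X_{m-2}-q^2X_{m-3}\qquad (X=A,B,C),$$ with initial values $$A_0=1,\ A_1=0,\ A_2=0;\qquad B_0=-q,\ B_1=-q,\ B_2=-q;\qquad C_0=0,\ C_1=0,\ C_2=q.$$ Then for every integer $m\ge 0$, $$\begin{aligned}\sum_{n=0}^{\infty}\frac{(-1)^n(q;q^2)_nq^{n^2+2mn}}{(-q;q^2)_{n+1}(q^4;q^4)_n}&=\frac{(-1)^mq^{-m}(-q^2,-q^3,q^5;q^5)_{\infty}(q;q^2)_{\infty}}{(q^2;q^2)_{\infty}}A_m\\&\quad+\frac{(-1)^mq^{-m}(q^{10};q^{10})_{\infty}(q^{20};q^{20})_{\infty}}{(q;q^2)_{\infty}(q^5;q^{20})_{\infty}(q^4;q^4)_{\infty}}B_m\\&\quad+\frac{(-1)^mq^{-m}(-q,-q^4,q^5;q^5)_{\infty}(q;q^2)_{\infty}}{(q^2;q^2)_{\infty}}C_m.\end{aligned}$$ (2) Let $(E_m)_{m\ge 0}$, $(F_m)_{m\ge 0}$, $(G_m)_{m\ge 0}$ be the sequences each satisfying, for $m\ge 3$, the recursion $$X_m=-(q+q^{2m-3})X_{m-1}+(1+q^{2m-4})X_{m-2}+qX_{m-3}\qquad (X=E,F,G),$$ with initial values $$E_0=1,\ E_1=0,\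 E_2=1;\qquad F_0=0,\ F_1=0,\ F_2=2q;\qquad G_0=0,\ G_1=1,\ G_2=-q.$$ Then for every integer $m\ge 0$, $$\begin{aligned}\sum_{n=0}^{\infty}\frac{(-1)^n(q;q^2)_nq^{n^2+2mn}}{(-q;q^2)_n(q^4;q^4)_n}&=\frac{(-q^2,-q^3,q^5;q^5)_{\infty}(q;q^2)_{\infty}}{(q^2;q^2)_{\infty}}E_m\\&\quad+\frac{(q^{10};q^{10})_{\infty}(q^{20};q^{20})_{\infty}}{(q;q^2)_{\infty}(q^5;q^{20})_{\infty}(q^4;q^4)_{\infty}}F_m\\&\quad+\frac{(-q,-q^4,q^5;q^5)_{\infty}(q;q^2)_{\infty}}{(q^2;q^2)_{\infty}}G_m.\end{aligned}$$
   Context: For $|p|<1$, $(a;p)_\infty=\prod_{k=0}^{\infty}(1-ap^k)$ and, for an integer $n\ge 0$, $(a;p)_n=\prod_{k=0}^{n-1}(1-ap^k)$. Multiple $q$-shifted factorials are products: $(a_1,\dots,a_r;p)_\infty=(a_1;p)_\infty\cdots(a_r;p)_\infty$.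
   Formalization: The printed product multiplying B_m and F_m is wrong (part (1), m=0 fails at order q^2); in it (q;q^2)_∞ is replaced by (-q;q^2)_∞ and (q^5;q^{20})_∞ by (q^5,q^{15},q^{20};q^{20})_∞. *)

theory Defs
  imports "HOL-Analysis.Analysis"
begin

definition qpoch :: "complex \<Rightarrow> complex \<Rightarrow> nat \<Rightarrow> complex" where
  "qpoch a p n = (\<Prod>k<n. 1 - a * p ^ k)"

(* Meaningful for norm p < 1, where the product converges absolutely. The library's prodinf
   allows vanishing factors; the value is then 0. *)
definition qpoch_inf :: "complex \<Rightarrow> complex \<Rightarrow> complex" where
  "qpoch_inf a p = (\<Prod>k. 1 - a * p ^ k)"

definition qpochs_inf :: "complex list \<Rightarrow> complex \<Rightarrow> complex" where
  "qpochs_inf as p = (\<Prod>a\<leftarrow>as. qpoch_inf a p)"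

(* The product that multiplies B_m and F_m. It departs from the source, which has
     (q^10;q^10) (q^20;q^20) / ((q;q^2) (q^5;q^20) (q^4;q^4));
   with that product both claims fail (numerically at q = 0.4, for m = 0 in the first and
   m = 2 in the second). The remaining data determine the factor uniquely, and it is the
   product below, with (-q;q^2) for (q;q^2) and (q^5,q^15,q^20;q^20) for (q^5;q^20).
   It equals psi(q^5) / psi(q) for Ramanujan's psi(q) = (q^2;q^2) / (q;q^2). *)
definition middle_product :: "complex \<Rightarrow> complex" where
  "middle_product q =
     qpoch_inf (q^10) (q^10) * qpoch_inf (q^20) (q^20) /
     (qpoch_inf (- q) (q^2) * qpochs_inf [q^5, q^15, q^20] (q^20) * qpoch_inf (q^4) (q^4))"

end

theory Submission
  imports Defs "HOL-Library.Nat_Bijection"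
begin

text \<open>
  Write \<open>moment e m\<close> for the series with \<open>(-q;q^2)_{n+e}\<close> in the denominator. Comparing consecutive
  terms gives \<open>moment 0 m = moment 1 m + q * moment 1 (m + 1)\<close> and a third order recurrence in \<open>m\<close>
  for \<open>moment 1\<close>, so everything follows from the values of \<open>moment 0 0\<close>, \<open>moment 0 1\<close> and
  \<open>moment 1 1\<close>. These are Rogers--Ramanujan type identities. The reciprocals of the denominators are
  bilateral sums
  \<open>\<Sum>r. (-1)^r q^((3r^2 \<plusminus> r)/2) / ((q^2;q^2)_{n-r} (q^2;q^2)_{n+r+e})\<close>,
  which the \<open>q\<close>-Pascal rule evaluates by induction on \<open>n\<close>. Interchanging the summations, the sum over
  \<open>n\<close> is a \<open>1phi1\<close> with a product value, and what remains is a theta series with quadratic exponent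
  \<open>5r^2/2\<close>, to which the Jacobi triple product applies.
\<close>

section \<open>The \<open>q\<close>-shifted factorials\<close>

text \<open>The inner sum over \<open>n\<close> matches the summable \<open>1phi1\<close> exactly
  when the shift \<open>m\<close> equals the width \<open>e\<close> of the kernel
  \<open>1 / ((q^2;q^2)_{n-r} (q^2;q^2)_{n+r+e})\<close>. This leaves \<open>m = e = 0\<close> and
  \<open>m = e = 1\<close>. Width 0 yields one value. Width 1 yields two, because there the
  exponents \<open>(3r^2 + r)/2\<close> and \<open>(3r^2 - r)/2\<close> produce the denominators
  with \<open>(-q;q^2)_{n+1}\<close> and \<open>(-q;q^2)_n\<close> respectively. So three moments
  are directly accessible, as many as a third order recurrence asks for. The obstacle is at width 1:
  the value of the \<open>1phi1\<close> lacks the factor \<open>1 - q^(2r+1)\<close> of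
  \<open>(q;q^2)_inf\<close>, so the series over \<open>r\<close> carries this denominator and is
  not yet a theta series. Pairing \<open>r\<close> with \<open>-r-1\<close> removes it.\<close>

lemma qpoch_0 [simp]: "qpoch a p 0 = 1"
  by (simp add: qpoch_def)

lemma qpoch_Suc: "qpoch a p (Suc n) = qpoch a p n * (1 - a * p ^ n)"
  by (simp add: qpoch_def)

lemma qpoch_add: "qpoch a p (m + n) = qpoch a p m * qpoch (a * p ^ m) p n"
  by (induction n) (simp_all add: qpoch_Suc power_add mult.assoc)

lemma qpoch_nonzero: "(\<And>k. a * p ^ k \<noteq> 1) \<Longrightarrow> qpoch a p n \<noteq> 0"
  by (auto simp: qpoch_def)

lemma power_neq_1_complex:
  fixes p :: complex
  assumes "norm p < 1" "0 < k"
  shows "p ^ k \<noteq> 1"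
  by (metis assms norm_one norm_power norm_ge_zero order_less_irrefl power_less_one_iff)

lemma mult_power_neq_1_complex:
  fixes a p :: complex
  assumes "norm p < 1" "norm a < 1"
  shows "a * p ^ k \<noteq> 1"
proof -
  have "norm (a * p ^ k) \<le> norm a * 1"
    unfolding norm_mult norm_power using assms by (intro mult_left_mono power_le_one) auto
  then show ?thesis
    using assms by auto
qed

lemma convergent_prod_qpoch:
  fixes a p :: complex
  assumes "norm p < 1"
  shows "convergent_prod (\<lambda>k. 1 - a * p ^ k)"
proof (rule abs_convergent_prod_imp_convergent_prod)
  have "summable (\<lambda>k. norm a * norm p ^ k)"
    using assms by (intro summable_mult summable_geometric) auto
  then show "abs_convergent_prod (\<lambda>k. 1 - a * p ^ k)"
    by (simp add: abs_convergent_prod_conv_summable norm_mult norm_power)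
qed

lemma qpoch_tendsto:
  assumes "norm p < 1"
  shows "(\<lambda>n. qpoch a p n) \<longlonglongrightarrow> qpoch_inf a p"
proof -
  have "(\<lambda>n. qpoch a p (Suc n)) \<longlonglongrightarrow> qpoch_inf a p"
    using convergent_prod_LIMSEQ[OF convergent_prod_qpoch[OF assms, of a]]
    by (simp add: qpoch_def qpoch_inf_def lessThan_Suc_atMost)
  then show ?thesis
    by (rule LIMSEQ_imp_Suc)
qed

lemma qpoch_inf_nonzero:
  assumes "norm p < 1" "\<And>k. a * p ^ k \<noteq> 1"
  shows "qpoch_inf a p \<noteq> 0"
  unfolding qpoch_inf_def
  by (rule prodinf_nonzero[OF convergent_prod_qpoch[OF assms(1)]]) (metis assms(2) eq_iff_diff_eq_0)

lemma qpoch_inf_split: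
  assumes "norm p < 1"
  shows "qpoch_inf a p = qpoch a p m * qpoch_inf (a * p ^ m) p"
proof (rule LIMSEQ_unique)
  show "(\<lambda>n. qpoch a p (m + n)) \<longlonglongrightarrow> qpoch_inf a p"
    using LIMSEQ_ignore_initial_segment[OF qpoch_tendsto[OF assms], of a m] by (simp add: add.commute)
  show "(\<lambda>n. qpoch a p (m + n)) \<longlonglongrightarrow> qpoch a p m * qpoch_inf (a * p ^ m) p"
    unfolding qpoch_add by (intro tendsto_intros qpoch_tendsto assms)
qed

lemma qpoch_bounded:
  assumes "norm p < 1"
  obtains C where "0 < C" "\<And>n. norm (qpoch a p n) \<le> C"
  using qpoch_tendsto[OF assms, of a, THEN convergentI, THEN convergent_imp_Bseq]
  by (auto simp: Bseq_def)

lemma inverse_qpoch_bounded: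
  assumes "norm p < 1" "\<And>k. a * p ^ k \<noteq> 1"
  obtains C where "0 < C" "\<And>n. norm (inverse (qpoch a p n)) \<le> C"
proof -
  have "(\<lambda>n. inverse (qpoch a p n)) \<longlonglongrightarrow> inverse (qpoch_inf a p)"
    by (intro tendsto_inverse qpoch_tendsto qpoch_inf_nonzero assms)
  then have "Bseq (\<lambda>n. inverse (qpoch a p n))"
    by (blast intro: convergentI convergent_imp_Bseq)
  then show ?thesis
    using that by (auto simp: Bseq_def)
qed

section \<open>The summation of \<open>1phi1\<close>\<close>

lemma Suc_choose_two: "Suc n choose 2 = n + (n choose 2)"
  by (simp add: numeral_2_eq_2)

lemma two_choose_two: "2 * (n choose 2) + n = n\<^sup>2"
  by (induction n) (auto simp: Suc_choose_two power2_eq_square)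

text \<open>The ratio of consecutive terms is \<open>w * p ^ k\<close>, which tends to 0 whatever
  \<open>w\<close> is.\<close>

lemma summable_partial_theta:
  fixes p w :: real
  assumes "0 \<le> p" "p < 1"
  shows "summable (\<lambda>k. w ^ k * p ^ (k choose 2))"
proof (rule summable_norm_cancel)
  have "(\<lambda>k. \<bar>w\<bar> * p ^ k) \<longlonglongrightarrow> \<bar>w\<bar> * 0"
    using assms by (intro tendsto_intros LIMSEQ_realpow_zero)
  then have "eventually (\<lambda>k. \<bar>w\<bar> * p ^ k < 1/2) sequentially"
    by (rule order_tendstoD) simp
  then obtain N where N: "\<And>k. k \<ge> N \<Longrightarrow> \<bar>w\<bar> * p ^ k < 1/2"
    by (auto simp: eventually_sequentially)
  show "summable (\<lambda>k. norm (w ^ k * p ^ (k choose 2)))"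
  proof (rule summable_ratio_test[of "1/2" N])
    fix k assume "N \<le> k"
    have "norm (norm (w ^ Suc k * p ^ (Suc k choose 2)))
        = (\<bar>w\<bar> * p ^ k) * norm (norm (w ^ k * p ^ (k choose 2)))"
      using assms by (simp add: Suc_choose_two power_add abs_mult)
    also have "\<dots> \<le> 1/2 * norm (norm (w ^ k * p ^ (k choose 2)))"
      using N[OF \<open>N \<le> k\<close>] by (intro mult_right_mono) auto
    finally show "norm (norm (w ^ Suc k * p ^ (Suc k choose 2)))
        \<le> 1/2 * norm (norm (w ^ k * p ^ (k choose 2)))" .
  qed simp
qed

text \<open>The terms of the \<open>1phi1\<close> with numerator parameter \<open>a\<close>,
  denominator parameter \<open>c = a * z\<close> and argument \<open>c / a\<close>. Using
  \<open>z\<close> in place of \<open>c\<close> avoids the division by \<open>a\<close>.\<close>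

definition phi11_term :: "complex \<Rightarrow> complex \<Rightarrow> complex \<Rightarrow> nat \<Rightarrow> complex" where
  "phi11_term a p z k =
     qpoch a p k * (- z) ^ k * p ^ (k choose 2) / (qpoch p p k * qpoch (a * z) p k)"

text \<open>Uniformity in \<open>N\<close> is the point: \<open>N = 0\<close> gives summability, and
  all \<open>N\<close> together give the dominating series for the limit in which
  \<open>z * p ^ N\<close> tends to 0.\<close>

lemma phi11_term_bound:
  assumes p: "norm p < 1" and az: "\<And>k. a * z * p ^ k \<noteq> 1"
  obtains C where "\<And>N k. norm (phi11_term a p (z * p ^ N) k)
      \<le> C * (norm z ^ k * norm p ^ (k choose 2))"
proof -
  have pp: "p * p ^ k \<noteq> 1" for k
    using power_neq_1_complex[OF p, of "Suc k"] by simp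
  obtain C1 where C1: "0 < C1" "\<And>n. norm (qpoch a p n) \<le> C1"
    using qpoch_bounded[OF p, where a = a] by blast
  obtain C2 where C2: "0 < C2" "\<And>n. norm (qpoch (a * z) p n) \<le> C2"
    using qpoch_bounded[OF p, where a = "a * z"] by blast
  obtain C3 where C3: "0 < C3" "\<And>n. norm (inverse (qpoch p p n)) \<le> C3"
    using inverse_qpoch_bounded[OF p pp] by blast
  obtain C4 where C4: "0 < C4" "\<And>n. norm (inverse (qpoch (a * z) p n)) \<le> C4"
    using inverse_qpoch_bounded[OF p az] by blast
  have "norm (phi11_term a p (z * p ^ N) k)
      \<le> (C1 * C3 * (C2 * C4)) * (norm z ^ k * norm p ^ (k choose 2))" for N k
  proof -
    have split: "inverse (qpoch (a * (z * p ^ N)) p k)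
        = qpoch (a * z) p N * inverse (qpoch (a * z) p (N + k))"
      unfolding qpoch_add using qpoch_nonzero[of "a * z" p N] az
      by (simp add: field_simps)
    have "norm (phi11_term a p (z * p ^ N) k)
        = (norm (qpoch a p k) * norm (inverse (qpoch p p k))
          * (norm (qpoch (a * z) p N) * norm (inverse (qpoch (a * z) p (N + k)))))
          * ((norm z * norm p ^ N) ^ k * norm p ^ (k choose 2))"
      unfolding phi11_term_def divide_inverse inverse_mult_distrib split
      by (simp add: norm_mult norm_power power_mult_distrib)
    also have "\<dots> \<le> (C1 * C3 * (C2 * C4)) * ((norm z * 1) ^ k * norm p ^ (k choose 2))"
      using C1 C2 C3 C4 p
      by (intro mult_mono power_mono mult_nonneg_nonneg power_le_one) auto
    finally show ?thesis by simp
  qed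
  then show ?thesis using that by blast
qed

lemma summable_phi11_term:
  assumes p: "norm p < 1" and az: "\<And>k. a * z * p ^ k \<noteq> 1"
  shows "summable (phi11_term a p z)"
proof -
  obtain C where C: "\<And>N k. norm (phi11_term a p (z * p ^ N) k)
      \<le> C * (norm z ^ k * norm p ^ (k choose 2))"
    using phi11_term_bound[OF assms] by blast
  show ?thesis
  proof (rule summable_comparison_test')
    show "summable (\<lambda>k. C * (norm z ^ k * norm p ^ (k choose 2)))"
      using p by (intro summable_mult summable_partial_theta) auto
    show "norm (phi11_term a p z k) \<le> C * (norm z ^ k * norm p ^ (k choose 2))" for k
      using C[of 0 k] by simp
  qed
qed

text \<open>
  The certificate \<open>(1 - p^k) * phi11_term a p z k\<close> makes the contiguous relation between \<open>z\<close> and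
  \<open>z * p\<close> telescope.
\<close>

lemma phi11_term_telescope:
  assumes p: "norm p < 1" and az: "\<And>k. a * z * p ^ k \<noteq> 1"
  shows "(1 - a * z) * phi11_term a p z k - (1 - z) * phi11_term a p (z * p) k
    = (1 - a * z) * ((1 - p ^ k) * phi11_term a p z k - (1 - p ^ Suc k) * phi11_term a p z (Suc k))"
proof -
  \<comment> \<open>\<open>W\<close> carries the common denominator
    \<open>(p;p)_k (az;p)_{k+1}\<close>, so that all terms involved are polynomial multiples of
    it.\<close>
  define W where "W
      = qpoch a p k * (- z) ^ k * p ^ (k choose 2) / (qpoch p p k * qpoch (a * z) p (Suc k))"
  have nz: "1 - a * z * p ^ j \<noteq> 0" for j
    using az[of j] by auto
  have nz1: "1 - a * z \<noteq> 0" using nz[of 0] by simp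
  have pk: "1 - p * p ^ k \<noteq> 0"
    using power_neq_1_complex[OF p, of "Suc k"] by auto
  have q1: "qpoch (a * z) p (Suc k) = (1 - a * z) * qpoch (a * z * p) p k"
    using qpoch_add[of "a * z" p 1 k] by (simp add: qpoch_Suc)
  have 1: "phi11_term a p z k = (1 - a * z * p ^ k) * W"
    using nz[of k] by (simp add: phi11_term_def W_def qpoch_Suc)
  have 2: "phi11_term a p (z * p) k = (1 - a * z) * p ^ k * W"
  proof -
    have e1: "(- (z * p)) ^ k = (- z) ^ k * p ^ k"
      by (metis minus_mult_left power_mult_distrib)
    have e2: "qpoch (a * (z * p)) p k = qpoch (a * z * p) p k"
      by (simp add: mult.assoc)
    show ?thesis
      unfolding phi11_term_def W_def q1 e1 e2 using nz1 by simp
  qed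
  have 3: "(1 - p ^ Suc k) * phi11_term a p z (Suc k) = (1 - a * p ^ k) * (- z) * p ^ k * W"
    using pk by (simp add: phi11_term_def W_def qpoch_Suc[of p] qpoch_Suc[of a] Suc_choose_two power_add)
  show ?thesis
    unfolding 1 2 3 by (simp add: algebra_simps)
qed

lemma phi11_contiguous:
  assumes p: "norm p < 1" and az: "\<And>k. a * z * p ^ k \<noteq> 1"
  shows "(1 - a * z) * suminf (phi11_term a p z) = (1 - z) * suminf (phi11_term a p (z * p))"
proof -
  have az': "a * (z * p) * p ^ k \<noteq> 1" for k
    using az[of "Suc k"] by (simp add: mult_ac)
  note s = summable_phi11_term[OF p az] summable_phi11_term[OF p az']
  let ?G = "\<lambda>k. (1 - a * z) * ((1 - p ^ k) * phi11_term a p z k)"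
  \<comment> \<open>The certificate vanishes at both ends: at \<open>k = 0\<close> through
    \<open>1 - p ^ 0\<close>, at infinity because the terms are summable.\<close>
  have "?G \<longlonglongrightarrow> (1 - a * z) * ((1 - 0) * 0)"
    using p by (intro tendsto_intros LIMSEQ_power_zero summable_LIMSEQ_zero s)
  then have "(\<lambda>k. ?G k - ?G (Suc k)) sums (?G 0 - 0)"
    by (intro telescope_sums') simp
  then have "(\<lambda>k. (1 - a * z) * phi11_term a p z k - (1 - z) * phi11_term a p (z * p) k) sums 0"
    unfolding phi11_term_telescope[OF assms] by (simp add: right_diff_distrib)
  moreover have "(\<lambda>k. (1 - a * z) * phi11_term a p z k - (1 - z) * phi11_term a p (z * p) k) sums
     ((1 - a * z) * suminf (phi11_term a p z) - (1 - z) * suminf (phi11_term a p (z * p)))"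
    by (intro sums_diff sums_mult summable_sums s)
  ultimately show ?thesis
    using sums_unique2 by force
qed

text \<open>Iterating the contiguous relation moves the argument to \<open>z * p ^ N\<close>. As
  \<open>N\<close> grows, every term but the one at \<open>k = 0\<close> dies, so the series tends
  to 1.\<close>

theorem phi11_sum:
  assumes p: "norm p < 1" and az: "\<And>k. a * z * p ^ k \<noteq> 1"
  shows "phi11_term a p z sums (qpoch_inf z p / qpoch_inf (a * z) p)"
proof -
  let ?F = "\<lambda>z. suminf (phi11_term a p z)"
  have iter: "qpoch (a * z) p N * ?F z = qpoch z p N * ?F (z * p ^ N)" for N
  proof (induction N)
    case (Suc N)
    have az': "a * (z * p ^ N) * p ^ k \<noteq> 1" for k
      using az[of "N + k"] by (simp add: power_add mult_ac)
    have "(1 - a * z * p ^ N) * ?F (z * p ^ N) = (1 - z * p ^ N) * ?F (z * p ^ Suc N)"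
      using phi11_contiguous[OF p az'] by (simp add: mult_ac)
    moreover have "qpoch (a * z) p (Suc N) * ?F z = (1 - a * z * p ^ N) * (qpoch (a * z) p N * ?F z)"
      by (simp add: qpoch_Suc)
    ultimately have "qpoch (a * z) p (Suc N) * ?F z
        = qpoch z p N * ((1 - z * p ^ N) * ?F (z * p ^ Suc N))"
      unfolding Suc by (metis mult.left_commute)
    then show ?case
      by (simp add: qpoch_Suc mult.assoc)
  qed simp
  obtain C where C: "\<And>N k. norm (phi11_term a p (z * p ^ N) k)
      \<le> C * (norm z ^ k * norm p ^ (k choose 2))"
    using phi11_term_bound[OF assms] by blast
  have lim0: "(\<lambda>N. phi11_term a p (z * p ^ N) k) \<longlonglongrightarrow> (if k = 0 then 1 else 0)" for k
  proof (cases "k = 0")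
    case False
    have "(\<lambda>N. (qpoch (a * z) p N * inverse (qpoch (a * z) p (N + k)))
        * (qpoch a p k * p ^ (k choose 2) / qpoch p p k) * (- (z * p ^ N)) ^ k)
       \<longlonglongrightarrow> (qpoch_inf (a * z) p * inverse (qpoch_inf (a * z) p))
        * (qpoch a p k * p ^ (k choose 2) / qpoch p p k) * (- (z * 0)) ^ k"
      using p az qpoch_nonzero[OF az]
      by (intro tendsto_intros LIMSEQ_ignore_initial_segment qpoch_tendsto LIMSEQ_power_zero
          qpoch_inf_nonzero) auto
    moreover have "phi11_term a p (z * p ^ N) k =
       (qpoch (a * z) p N * inverse (qpoch (a * z) p (N + k)))
        * (qpoch a p k * p ^ (k choose 2) / qpoch p p k) * (- (z * p ^ N)) ^ k" for N
      unfolding qpoch_add phi11_term_def using qpoch_nonzero[OF az, of N]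
      by (simp add: field_simps)
    ultimately show ?thesis using False by (simp add: power_0_left)
  qed (simp add: phi11_term_def binomial_eq_0)
  have "(\<lambda>N. ?F (z * p ^ N)) \<longlonglongrightarrow> suminf (\<lambda>k. if k = 0 then 1 else 0 :: complex)"
  proof (rule conjunct2[OF conjunct2[OF tannerys_theorem]])
    show "summable (\<lambda>k. C * (norm z ^ k * norm p ^ (k choose 2)))"
      using p by (intro summable_mult summable_partial_theta) auto
    show "\<forall>\<^sub>F (k, N) in sequentially \<times>\<^sub>F sequentially.
       norm (phi11_term a p (z * p ^ N) k) \<le> C * (norm z ^ k * norm p ^ (k choose 2))"
      using C by (intro always_eventually) auto
  qed (use lim0 in auto)
  moreover have "suminf (\<lambda>k. if k = 0 then 1 else 0 :: complex) = 1"
    using sums_single[of 0 "\<lambda>_. 1::complex"] by (simp add: sums_iff)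
  ultimately have "(\<lambda>N. qpoch z p N * ?F (z * p ^ N)) \<longlonglongrightarrow> qpoch_inf z p * 1"
    by (intro tendsto_intros qpoch_tendsto p) simp
  moreover have "(\<lambda>N. qpoch (a * z) p N * ?F z) \<longlonglongrightarrow> qpoch_inf (a * z) p * ?F z"
    by (intro tendsto_intros qpoch_tendsto p)
  ultimately have "qpoch_inf (a * z) p * ?F z = qpoch_inf z p"
    unfolding iter using LIMSEQ_unique by fastforce
  then have "?F z = qpoch_inf z p / qpoch_inf (a * z) p"
    using qpoch_inf_nonzero[OF p az] by (simp add: field_simps)
  then show ?thesis
    using summable_sums[OF summable_phi11_term[OF assms]] by simp
qed

section \<open>Bilateral sums and the Jacobi triple product\<close>

text \<open>Continues \<open>n choose 2\<close> to all integers. Quadratic exponents such as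
  \<open>(3r^2 + r)/2\<close> become integer combinations \<open>3 * tri r + 2 * r\<close>, so
  reflections and shifts are linear arithmetic in \<open>tri r\<close> and \<open>r\<close>.\<close>

definition tri :: "int \<Rightarrow> int" where
  "tri r = r * (r - 1) div 2"

lemma two_tri: "2 * tri r = r * (r - 1)"
  unfolding tri_def by (rule dvd_mult_div_cancel) simp

lemma tri_plus_1: "tri (r + 1) = tri r + r" "tri (1 + r) = tri r + r"
  using two_tri[of r] two_tri[of "r + 1"] by (simp_all add: algebra_simps)

lemma tri_minus_1: "tri (r - 1) = tri r - r + 1"
  using tri_plus_1(1)[of "r - 1"] by simp

lemma tri_uminus: "tri (- r) = tri r + r"
  using two_tri[of r] two_tri[of "- r"] by (simp add: algebra_simps)

lemma tri_reflect: "tri (- r - 1) = tri r + 2 * r + 1"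
  using two_tri[of r] two_tri[of "- r - 1"] by (simp add: algebra_simps)

lemma tri_of_nat: "tri (int n) = int (n choose 2)"
proof (induction n)
  case (Suc n)
  then show ?case
    using tri_plus_1[of "int n"] by (simp add: Suc_choose_two add.commute)
qed (simp add: tri_def binomial_eq_0)

lemma abs_summable_on_int:
  fixes f :: "int \<Rightarrow> 'a::real_normed_vector"
  assumes "summable (\<lambda>n. norm (f (int n)))" "summable (\<lambda>n. norm (f (- int n)))"
  shows "(\<lambda>r. norm (f r)) summable_on UNIV"
proof -
  have U: "(UNIV :: int set) = range int \<union> range (\<lambda>n. - int n)"
    by (auto simp: image_iff) (metis int_cases2)
  have "(\<lambda>r. norm (f r)) summable_on range int"
    using assms(1) by (subst summable_on_reindex) (auto simp: o_def summable_on_UNIV_nonneg_real_iff)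
  moreover have "(\<lambda>r. norm (f r)) summable_on range (\<lambda>n. - int n)"
    using assms(2) by (subst summable_on_reindex) (auto simp: o_def inj_def summable_on_UNIV_nonneg_real_iff)
  ultimately show ?thesis
    unfolding U by (rule summable_on_union)
qed

lemma abs_summable_theta:
  fixes p z :: complex
  assumes p: "norm p < 1" "p \<noteq> 0" and z: "z \<noteq> 0"
  shows "(\<lambda>r. norm (p powi tri r * z powi r)) summable_on UNIV"
proof (rule abs_summable_on_int)
  have "norm (p powi tri (int n) * z powi int n) = norm z ^ n * norm p ^ (n choose 2)" for n
    by (simp add: tri_of_nat norm_mult norm_power mult.commute)
  then show "summable (\<lambda>n. norm (p powi tri (int n) * z powi int n))"
    using summable_partial_theta[of "norm p" "norm z"] p by simp
  \<comment> \<open>On the negative half \<open>tri (- n) = tri n + n\<close>, which replaces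
    \<open>z\<close> by \<open>p / z\<close>.\<close>
  have "norm (p powi tri (- int n) * z powi (- int n)) = norm (p / z) ^ n * norm p ^ (n choose 2)" for n
    using p by (simp add: tri_uminus tri_of_nat power_int_add norm_mult norm_power norm_divide
        power_int_minus power_divide norm_inverse divide_inverse power_inverse power_mult_distrib mult_ac)
  then show "summable (\<lambda>n. norm (p powi tri (- int n) * z powi (- int n)))"
    using summable_partial_theta[of "norm p" "norm (p / z)"] p by simp
qed

text \<open>
  The value \<open>0\<close> at negative arguments makes the finite bilateral sums below range over all integers,
  and it is the one for which \<open>inv_qfact_minus_1\<close> holds at every integer.
\<close>

definition inv_qfact :: "complex \<Rightarrow> int \<Rightarrow> complex" where
  "inv_qfact p k = (if k < 0 then 0 else inverse (qpoch p p (nat k)))"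

lemma qpoch_self_nonzero:
  assumes "norm p < 1"
  shows "qpoch p p n \<noteq> 0"
  by (rule qpoch_nonzero) (use mult_power_neq_1_complex[OF assms assms] in blast)

lemma inv_qfact_minus_1:
  assumes "norm p < 1"
  shows "inv_qfact p (k - 1) = (1 - p powi k) * inv_qfact p k"
proof (cases "k > 0")
  case True
  then obtain j where k: "k = int (Suc j)"
    by (metis gr0_implies_Suc zero_less_imp_eq_int)
  have "nat (1 + int j) = Suc j" "p powi (1 + int j) = p ^ Suc j"
    using power_int_of_nat[of p "Suc j"] by simp_all
  then show ?thesis
    using qpoch_self_nonzero[OF assms, of "Suc j"]
    by (simp add: k inv_qfact_def qpoch_Suc field_simps flip: power_Suc)
qed (auto simp: inv_qfact_def)

text \<open>This is \<open>1 - p^(a+b) = (1 - p^a) + p^a (1 - p^b)\<close>, the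
  \<open>q\<close>-Pascal rule written for reciprocals of factorials and valid at all
  integers.\<close>

lemma inv_qfact_pascal:
  assumes "norm p < 1" "p \<noteq> 0"
  shows "(1 - p powi (a + b)) * (inv_qfact p a * inv_qfact p b)
    = inv_qfact p (a - 1) * inv_qfact p b + p powi a * (inv_qfact p a * inv_qfact p (b - 1))"
  using assms by (simp add: inv_qfact_minus_1 power_int_add algebra_simps)

lemma inv_qfact_bounded:
  assumes "norm p < 1"
  obtains C where "0 < C" "\<And>k. norm (inv_qfact p k) \<le> C"
proof -
  obtain C where C: "0 < C" "\<And>n. norm (inverse (qpoch p p n)) \<le> C"
    using inverse_qpoch_bounded[of p p] mult_power_neq_1_complex[of p p] assms by metis
  then have "norm (inv_qfact p k) \<le> C" for k
    by (simp add: inv_qfact_def less_imp_le)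
  then show ?thesis using that C(1) by blast
qed

lemma inv_qfact_tendsto:
  assumes "norm p < 1"
  shows "(\<lambda>n. inv_qfact p (int n + r)) \<longlonglongrightarrow> inverse (qpoch_inf p p)"
proof -
  have "(\<lambda>n. inverse (qpoch p p n)) \<longlonglongrightarrow> inverse (qpoch_inf p p)"
    by (intro tendsto_inverse qpoch_tendsto qpoch_inf_nonzero mult_power_neq_1_complex assms)
  moreover have "filterlim (\<lambda>n. nat (int n + r)) at_top sequentially"
    unfolding filterlim_at_top eventually_sequentially
  proof safe
    fix Z show "\<exists>N. \<forall>n\<ge>N. Z \<le> nat (int n + r)"
      by (rule exI[of _ "Z + nat (- r)"]) auto
  qed
  ultimately have "(\<lambda>n. inverse (qpoch p p (nat (int n + r)))) \<longlonglongrightarrow> inverse (qpoch_inf p p)"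
    by (rule filterlim_compose)
  moreover have "\<forall>\<^sub>F n in sequentially. inverse (qpoch p p (nat (int n + r))) = inv_qfact p (int n + r)"
    using eventually_ge_at_top[of "nat (- r)"] by eventually_elim (auto simp: inv_qfact_def)
  ultimately show ?thesis
    by (rule Lim_transform_eventually)
qed

text \<open>
  The \<open>\<beta>\<close> side of a Bailey pair relative to \<open>p^e\<close> for \<open>e = 0, 1\<close>, up to the factor
  \<open>(p;p)_e\<close>, with the sequence \<open>\<alpha>\<close> spread over all integers.
\<close>

definition bsum :: "complex \<Rightarrow> nat \<Rightarrow> nat \<Rightarrow> (int \<Rightarrow> complex) \<Rightarrow> complex" where
  "bsum p e n f = (\<Sum>\<^sub>\<infinity>r. f r * (inv_qfact p (int n - r) * inv_qfact p (int n + r + int e)))"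

lemma bsum_summable:
  "(\<lambda>r. f r * (inv_qfact p (int n - r + c) * inv_qfact p (int n + r + d))) summable_on UNIV"
proof (rule finite_nonzero_values_imp_summable_on)
  have "{r \<in> UNIV. f r * (inv_qfact p (int n - r + c) * inv_qfact p (int n + r + d)) \<noteq> 0}
      \<subseteq> {- int n - d..int n + c}"
    by (auto simp: inv_qfact_def split: if_splits)
  then show "finite {r \<in> UNIV. f r * (inv_qfact p (int n - r + c) * inv_qfact p (int n + r + d)) \<noteq> 0}"
    by (rule finite_subset) simp
qed

lemma bsum_add: "bsum p e n (\<lambda>r. f r + g r) = bsum p e n f + bsum p e n g"
  unfolding bsum_def distrib_right
  by (rule infsum_add) (use bsum_summable[where c = 0] in auto)

lemma bsum_cmult: "bsum p e n (\<lambda>r. c * f r) = c * bsum p e n f"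
  unfolding bsum_def by (simp add: infsum_cmult_right' mult.assoc)

text \<open>The reflection \<open>r \<mapsto> - r - e\<close> exchanges the two factors of the
  kernel.\<close>

lemma bsum_reflect: "bsum p e n (\<lambda>r. f (- r - int e)) = bsum p e n f"
  unfolding bsum_def
  by (rule infsum_reindex_bij_witness[of _ "\<lambda>r. - r - int e" "\<lambda>r. - r - int e"])
    (auto simp: algebra_simps)

text \<open>The two arguments of the kernel add up to \<open>2 * n + 1\<close>, the exponent for the
  Pascal rule. Shifting \<open>r\<close> in its second summand brings both summands to the kernel of
  width 0.\<close>

lemma bsum_Suc_width:
  assumes p: "norm p < 1" "p \<noteq> 0"
  shows "(1 - p ^ (2 * n + 1)) * bsum p 1 n f = bsum p 0 n (\<lambda>r. f r + p powi (int n + r) * f (r - 1))"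
proof -
  let ?h = "inv_qfact p"
  have pas: "(1 - p ^ (2 * n + 1)) * (?h (int n - r) * ?h (int n + r + 1))
     = ?h (int n - r) * ?h (int n + r) + p powi (int n + r + 1) * (?h (int n - r - 1) * ?h (int n + r + 1))" for r
  proof -
    have "p ^ (2 * n + 1) = p powi ((int n + r + 1) + (int n - r))"
      by (simp add: add.commute flip: power_int_of_nat)
    then show ?thesis
      using inv_qfact_pascal[OF p, of "int n + r + 1" "int n - r"] by (simp add: mult_ac)
  qed
  have "(1 - p ^ (2 * n + 1)) * bsum p 1 n f
      = (\<Sum>\<^sub>\<infinity>r. f r * ((1 - p ^ (2 * n + 1)) * (?h (int n - r) * ?h (int n + r + 1))))"
    unfolding bsum_def by (subst infsum_cmult_right'[symmetric]) (simp add: mult_ac)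
  also have "\<dots> = (\<Sum>\<^sub>\<infinity>r. f r * (?h (int n - r) * ?h (int n + r))
      + (p powi (int n + r + 1) * f r) * (?h (int n - r - 1) * ?h (int n + r + 1)))"
    unfolding pas by (simp add: algebra_simps)
  also have "\<dots> = (\<Sum>\<^sub>\<infinity>r. f r * (?h (int n - r) * ?h (int n + r)))
      + (\<Sum>\<^sub>\<infinity>r. (p powi (int n + r + 1) * f r) * (?h (int n - r - 1) * ?h (int n + r + 1)))"
    by (rule infsum_add)
      (use bsum_summable[where c = 0 and d = 0] bsum_summable[where c = "-1" and d = 1] in auto)
  also have "(\<Sum>\<^sub>\<infinity>r. (p powi (int n + r + 1) * f r) * (?h (int n - r - 1) * ?h (int n + r + 1)))
     = (\<Sum>\<^sub>\<infinity>r. (p powi (int n + r) * f (r - 1)) * (?h (int n - r) * ?h (int n + r)))"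
    by (rule infsum_reindex_bij_witness[of _ "\<lambda>r. r - 1" "\<lambda>r. r + 1"]) (auto simp: algebra_simps)
  finally show ?thesis
    unfolding bsum_add by (simp add: bsum_def)
qed

text \<open>The same argument with total \<open>2 * n + 2\<close>. Together with the step in width
  it climbs from \<open>n\<close> to \<open>n + 1\<close>, passing through width 1.\<close>

lemma bsum_Suc_index:
  assumes p: "norm p < 1" "p \<noteq> 0"
  shows "(1 - p ^ (2 * n + 2)) * bsum p 0 (Suc n) f
      = bsum p 1 n (\<lambda>r. f r + p powi (int n - r) * f (r + 1))"
proof -
  let ?h = "inv_qfact p"
  have pas: "(1 - p ^ (2 * n + 2)) * (?h (int n - r + 1) * ?h (int n + r + 1))
     = ?h (int n - r) * ?h (int n + r + 1) + p powi (int n - r + 1) * (?h (int n - r + 1) * ?h (int n + r))" for r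
  proof -
    have "p ^ (2 * n + 2) = p powi ((int n - r + 1) + (int n + r + 1))"
      by (simp add: add.commute flip: power_int_of_nat)
    then show ?thesis
      using inv_qfact_pascal[OF p, of "int n - r + 1" "int n + r + 1"] by (simp add: mult_ac)
  qed
  have "(1 - p ^ (2 * n + 2)) * bsum p 0 (Suc n) f
      = (\<Sum>\<^sub>\<infinity>r. f r * ((1 - p ^ (2 * n + 2)) * (?h (int n - r + 1) * ?h (int n + r + 1))))"
    unfolding bsum_def by (subst infsum_cmult_right'[symmetric]) (simp add: algebra_simps)
  also have "\<dots> = (\<Sum>\<^sub>\<infinity>r. f r * (?h (int n - r) * ?h (int n + r + 1))
      + (p powi (int n - r + 1) * f r) * (?h (int n - r + 1) * ?h (int n + r)))"
    unfolding pas by (simp add: algebra_simps)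
  also have "\<dots> = (\<Sum>\<^sub>\<infinity>r. f r * (?h (int n - r) * ?h (int n + r + 1)))
      + (\<Sum>\<^sub>\<infinity>r. (p powi (int n - r + 1) * f r) * (?h (int n - r + 1) * ?h (int n + r)))"
    by (rule infsum_add)
      (use bsum_summable[where c = 0 and d = 1] bsum_summable[where c = 1 and d = 0] in auto)
  also have "(\<Sum>\<^sub>\<infinity>r. (p powi (int n - r + 1) * f r) * (?h (int n - r + 1) * ?h (int n + r)))
     = (\<Sum>\<^sub>\<infinity>r. (p powi (int n - r) * f (r + 1)) * (?h (int n - r) * ?h (int n + r + 1)))"
    by (rule infsum_reindex_bij_witness[of _ "\<lambda>r. r + 1" "\<lambda>r. r - 1"]) (auto simp: algebra_simps)
  finally show ?thesis
    unfolding bsum_add by (simp add: bsum_def)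
qed

text \<open>When the weighted shift acts on \<open>f\<close> as a scalar, the Pascal step closes up
  on \<open>f\<close> itself.\<close>

lemma bsum_Suc_width_eigen:
  assumes "norm p < 1" "p \<noteq> 0" "\<And>r. p powi (int n + r) * f (r - 1) = c * f r"
  shows "(1 - p ^ (2 * n + 1)) * bsum p 1 n f = (1 + c) * bsum p 0 n f"
  using bsum_Suc_width[OF assms(1,2), of n f] unfolding bsum_add assms(3) bsum_cmult
  by (simp add: algebra_simps)

lemma bsum_Suc_index_eigen:
  assumes "norm p < 1" "p \<noteq> 0" "\<And>r. p powi (int n - r) * f (r + 1) = c * f r"
  shows "(1 - p ^ (2 * n + 2)) * bsum p 0 (Suc n) f = (1 + c) * bsum p 1 n f"
  using bsum_Suc_index[OF assms(1,2), of n f] unfolding bsum_add assms(3) bsum_cmult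
  by (simp add: algebra_simps)

lemma bsum_0_0: "bsum p 0 0 f = f 0"
proof -
  have "bsum p 0 0 f = (\<Sum>\<^sub>\<infinity>r\<in>{0}. f r * (inv_qfact p (int 0 - r) * inv_qfact p (int 0 + r + int 0)))"
    unfolding bsum_def by (rule infsum_cong_neutral) (auto simp: inv_qfact_def)
  then show ?thesis by (simp add: inv_qfact_def)
qed

section \<open>The finite triple product and its limit\<close>

lemma one_minus_power_nonzero:
  fixes p :: complex
  assumes "norm p < 1" "0 < k"
  shows "1 - p ^ k \<noteq> 0"
  using power_neq_1_complex[OF assms] by auto

text \<open>The sequence \<open>p^(tri r) z^r\<close> is an eigenvector of both weighted shifts,
  with eigenvalues \<open>p^(n+1) / z\<close> and \<open>p^n z\<close>. These supply the next
  factors of \<open>(-p/z;p)_n\<close> and \<open>(-z;p)_n\<close>.\<close>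

lemma finite_jacobi_triple_product:
  assumes p: "norm p < 1" "p \<noteq> 0" and z: "z \<noteq> 0"
  shows "bsum p 0 n (\<lambda>r. p powi tri r * z powi r)
    = qpoch (- z) p n * qpoch (- p / z) p n / qpoch p p (2 * n)"
proof (induction n)
  case 0
  show ?case by (simp add: bsum_0_0 tri_def)
next
  case (Suc n)
  let ?f = "\<lambda>r. p powi tri r * z powi r"
  have "p powi (int n + r) * ?f (r - 1) = p ^ Suc n / z * ?f r" for r
    using p z by (simp add: tri_minus_1 power_int_add power_int_diff field_simps)
  note 1 = bsum_Suc_width_eigen[where f = ?f, OF p this]
  have "p powi (int n - r) * ?f (r + 1) = p ^ n * z * ?f r" for r
    using p z by (simp add: tri_plus_1 power_int_add power_int_diff field_simps)
  note 2 = bsum_Suc_index_eigen[where f = ?f, OF p this]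
  note nz = one_minus_power_nonzero[OF p(1), of "2 * n + 1"] one_minus_power_nonzero[OF p(1), of "2 * n + 2"]
  have solve: "b = c * d * a / (x * y)"
    if "x * (y * b) = c * (d * a)" "x \<noteq> 0" "y \<noteq> 0" for a b c d x y :: complex
    using that by (simp add: field_simps)
  have "bsum p 0 (Suc n) ?f = (1 + p ^ n * z) * (1 + p ^ Suc n / z) * bsum p 0 n ?f
      / ((1 - p ^ (2 * n + 1)) * (1 - p ^ (2 * n + 2)))"
  proof (rule solve)
    show "(1 - p ^ (2 * n + 1)) * ((1 - p ^ (2 * n + 2)) * bsum p 0 (Suc n) ?f)
      = (1 + p ^ n * z) * ((1 + p ^ Suc n / z) * bsum p 0 n ?f)"
      unfolding 2 1[symmetric] by (simp only: mult_ac)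
  qed (use nz in auto)
  also have "\<dots> = qpoch (- z) p (Suc n) * qpoch (- p / z) p (Suc n) / qpoch p p (2 * Suc n)"
    unfolding Suc by (simp add: qpoch_Suc mult_ac)
  finally show ?case .
qed

lemma infsum_int_eq_suminf:
  fixes f :: "int \<Rightarrow> complex"
  assumes "f summable_on UNIV"
  shows "infsum f UNIV = (\<Sum>k. f (int_decode k))"
proof -
  have "((\<lambda>k. f (int_decode k)) has_sum infsum f UNIV) UNIV"
    using has_sum_reindex_bij_betw[OF bij_int_decode, of f] assms by simp
  then show ?thesis
    using has_sum_imp_sums sums_unique by blast
qed

text \<open>In the limit of the finite form both factors of the kernel tend to
  \<open>1 / (p;p)_inf\<close>, while the right side retains only one such factor. The surplus
  becomes the third factor of the product.\<close>

theorem jacobi_triple_product: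
  assumes p: "norm p < 1" "p \<noteq> 0" and z: "z \<noteq> 0"
  shows "((\<lambda>r. p powi tri r * z powi r) has_sum
    (qpoch_inf (- z) p * qpoch_inf (- p / z) p * qpoch_inf p p)) UNIV"
proof -
  let ?f = "\<lambda>r. p powi tri r * z powi r"
  let ?g = "\<lambda>n r. ?f r * (inv_qfact p (int n - r) * inv_qfact p (int n + r))"
  note sum_f = abs_summable_theta[OF p z]
  have pinf: "qpoch_inf p p \<noteq> 0"
    by (intro qpoch_inf_nonzero mult_power_neq_1_complex p)
  obtain C where C: "0 < C" "\<And>k. norm (inv_qfact p k) \<le> C"
    using inv_qfact_bounded[OF p(1)] by blast
  \<comment> \<open>Tannery's theorem concerns series over the naturals, so the integers are
    enumerated by \<open>int_decode\<close>.\<close>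
  have lim: "(\<lambda>n. \<Sum>k. ?g n (int_decode k)) \<longlonglongrightarrow>
     (\<Sum>k. ?f (int_decode k) * (inverse (qpoch_inf p p) * inverse (qpoch_inf p p)))"
  proof (rule conjunct2[OF conjunct2[OF tannerys_theorem]])
    have "(\<lambda>k. norm (?f (int_decode k))) summable_on UNIV"
      using summable_on_reindex_bij_betw[OF bij_int_decode, of "\<lambda>r. norm (?f r)"] sum_f by simp
    then show "summable (\<lambda>k. norm (?f (int_decode k)) * (C * C))"
      by (intro summable_mult2 summable_on_imp_summable)
    show "\<forall>\<^sub>F (k, n) in sequentially \<times>\<^sub>F sequentially.
       norm (?g n (int_decode k)) \<le> norm (?f (int_decode k)) * (C * C)"
      using C by (intro always_eventually)
        (auto simp: norm_mult less_imp_le intro!: mult_left_mono mult_mono)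
    show "(\<lambda>n. ?g n (int_decode k)) \<longlonglongrightarrow>
      ?f (int_decode k) * (inverse (qpoch_inf p p) * inverse (qpoch_inf p p))" for k
      using inv_qfact_tendsto[OF p(1), of "- int_decode k"] inv_qfact_tendsto[OF p(1), of "int_decode k"]
      by (intro tendsto_intros) simp_all
  qed simp
  have summ: "?f summable_on UNIV"
    using sum_f by (rule abs_summable_summable)
  have 1: "(\<Sum>k. ?g n (int_decode k)) = qpoch (- z) p n * qpoch (- p / z) p n / qpoch p p (2 * n)" for n
    using infsum_int_eq_suminf[OF bsum_summable[of ?f p n 0 0]] finite_jacobi_triple_product[OF p z, of n]
    by (simp add: bsum_def)
  have 2: "(\<Sum>k. ?f (int_decode k) * (inverse (qpoch_inf p p) * inverse (qpoch_inf p p)))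
      = infsum ?f UNIV * (inverse (qpoch_inf p p) * inverse (qpoch_inf p p))"
    unfolding infsum_cmult_left'[symmetric]
    by (rule infsum_int_eq_suminf[symmetric]) (intro summable_on_cmult_left summ)
  have "(\<lambda>n. qpoch (- z) p n * qpoch (- p / z) p n / qpoch p p (2 * n)) \<longlonglongrightarrow>
     qpoch_inf (- z) p * qpoch_inf (- p / z) p / qpoch_inf p p"
  proof (intro tendsto_intros qpoch_tendsto p pinf)
    show "(\<lambda>n. qpoch p p (2 * n)) \<longlonglongrightarrow> qpoch_inf p p"
      using LIMSEQ_subseq_LIMSEQ[OF qpoch_tendsto[OF p(1)], of "\<lambda>n. 2 * n"]
      by (simp add: o_def strict_mono_def)
  qed
  from LIMSEQ_unique[OF lim[unfolded 1 2] this]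
  have "infsum ?f UNIV * (inverse (qpoch_inf p p) * inverse (qpoch_inf p p))
      = qpoch_inf (- z) p * qpoch_inf (- p / z) p / qpoch_inf p p" .
  then have "infsum ?f UNIV = qpoch_inf (- z) p * qpoch_inf (- p / z) p * qpoch_inf p p"
    using pinf by (simp add: field_simps)
  then show ?thesis
    using has_sum_infsum[OF summ] by simp
qed

section \<open>Bailey's transform\<close>

text \<open>The kernel is bounded, so the double series is dominated by the product of the
  absolutely convergent series of \<open>w\<close> and \<open>\<alpha>\<close>, and the order of
  summation may be exchanged. Rows give \<open>bsum\<close>, columns give
  \<open>\<delta>\<close>.\<close>

lemma bailey_interchange:
  fixes \<alpha> :: "int \<Rightarrow> complex" and w :: "nat \<Rightarrow> complex"
  assumes p: "norm p < 1" and w: "summable (\<lambda>n. norm (w n))" and \<alpha>: "(\<lambda>r. norm (\<alpha> r)) summable_on UNIV"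
    and conj: "\<And>r. (\<lambda>n. w n * (inv_qfact p (int n - r) * inv_qfact p (int n + r + int e))) sums \<delta> r"
  shows bailey_summable: "(\<lambda>r. \<alpha> r * \<delta> r) summable_on UNIV"
    and bailey_sums: "(\<lambda>n. w n * bsum p e n \<alpha>) sums (\<Sum>\<^sub>\<infinity>r. \<alpha> r * \<delta> r)"
proof -
  let ?h = "\<lambda>n r. inv_qfact p (int n - r) * inv_qfact p (int n + r + int e)"
  obtain C where C: "0 < C" "\<And>k. norm (inv_qfact p k) \<le> C"
    using inv_qfact_bounded[OF p] by blast
  have w': "(\<lambda>n. norm (w n)) summable_on UNIV"
    using w by (simp add: summable_on_UNIV_nonneg_real_iff)
  have "(\<lambda>(n, r). norm (w n) * norm (\<alpha> r)) summable_on UNIV \<times> UNIV"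
  proof (rule summable_on_SigmaI)
    show "((\<lambda>r. case (n, r) of (n, r) \<Rightarrow> norm (w n) * norm (\<alpha> r)) has_sum
        (norm (w n) * (\<Sum>\<^sub>\<infinity>r. norm (\<alpha> r)))) UNIV" for n
      using \<alpha> by (simp add: has_sum_cmult_right)
    show "(\<lambda>n. norm (w n) * (\<Sum>\<^sub>\<infinity>r. norm (\<alpha> r))) summable_on UNIV"
      by (intro summable_on_cmult_left w')
  qed auto
  then have "(\<lambda>x. (case x of (n, r) \<Rightarrow> norm (w n) * norm (\<alpha> r)) * (C * C)) summable_on UNIV \<times> UNIV"
    by (rule summable_on_cmult_left)
  then have "(\<lambda>x. norm (case x of (n, r) \<Rightarrow> \<alpha> r * (w n * ?h n r))) summable_on UNIV \<times> UNIV"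
  proof (rule summable_on_comparison_test)
    fix x :: "nat \<times> int"
    obtain n r where x: "x = (n, r)" by force
    have "norm (?h n r) \<le> C * C"
      unfolding norm_mult using C by (intro mult_mono) (auto simp: less_imp_le)
    then have "(norm (w n) * norm (\<alpha> r)) * norm (?h n r) \<le> (norm (w n) * norm (\<alpha> r)) * (C * C)"
      by (intro mult_left_mono) auto
    then show "norm (case x of (n, r) \<Rightarrow> \<alpha> r * (w n * ?h n r))
        \<le> (case x of (n, r) \<Rightarrow> norm (w n) * norm (\<alpha> r)) * (C * C)"
      by (simp add: x norm_mult mult_ac)
  qed simp
  then have S: "(\<lambda>(n, r). \<alpha> r * (w n * ?h n r)) summable_on UNIV \<times> UNIV"
    by (rule abs_summable_summable)
  have S': "(\<lambda>(r, n). \<alpha> r * (w n * ?h n r)) summable_on UNIV \<times> UNIV"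
    using summable_on_swap[of "\<lambda>(n, r). \<alpha> r * (w n * ?h n r)" UNIV UNIV] S
    by (simp add: case_prod_unfold)
  have row: "(\<Sum>\<^sub>\<infinity>r. \<alpha> r * (w n * ?h n r)) = w n * bsum p e n \<alpha>" for n
    unfolding bsum_def infsum_cmult_right'[symmetric] by (simp add: mult_ac)
  have col: "(\<Sum>\<^sub>\<infinity>n. \<alpha> r * (w n * ?h n r)) = \<alpha> r * \<delta> r" for r
  proof -
    have "(\<lambda>n. norm (w n) * (C * C)) summable_on UNIV"
      by (intro summable_on_cmult_left w')
    then have "(\<lambda>n. norm (w n * ?h n r)) summable_on UNIV"
    proof (rule summable_on_comparison_test)
      show "norm (w n * ?h n r) \<le> norm (w n) * (C * C)" for n
        unfolding norm_mult using C by (intro mult_left_mono mult_mono) (auto simp: less_imp_le)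
    qed auto
    then have "(\<lambda>n. w n * ?h n r) summable_on UNIV"
      by (rule abs_summable_summable)
    then have "(\<lambda>n. w n * ?h n r) sums (\<Sum>\<^sub>\<infinity>n. w n * ?h n r)"
      by (intro has_sum_imp_sums has_sum_infsum)
    from sums_unique2[OF this conj[of r]] show ?thesis
      unfolding infsum_cmult_right' by simp
  qed
  show "(\<lambda>r. \<alpha> r * \<delta> r) summable_on UNIV"
    using summable_on_Sigma_banach[OF S'] by (simp add: col)
  have "(\<lambda>n. w n * bsum p e n \<alpha>) summable_on UNIV"
    using summable_on_Sigma_banach[OF S] by (simp add: row)
  moreover have "(\<Sum>\<^sub>\<infinity>n. w n * bsum p e n \<alpha>) = (\<Sum>\<^sub>\<infinity>r. \<alpha> r * \<delta> r)"
    using infsum_swap_banach[OF S] unfolding row col .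
  ultimately show "(\<lambda>n. w n * bsum p e n \<alpha>) sums (\<Sum>\<^sub>\<infinity>r. \<alpha> r * \<delta> r)"
    using has_sum_imp_sums[OF has_sum_infsum, of "\<lambda>n. w n * bsum p e n \<alpha>"] by simp
qed

section \<open>Identities between infinite products\<close>

lemma qpoch_inf_mult_uminus:
  assumes "norm p < 1"
  shows "qpoch_inf a p * qpoch_inf (- a) p = qpoch_inf (a\<^sup>2) (p\<^sup>2)"
proof -
  have "qpoch a p n * qpoch (- a) p n = qpoch (a\<^sup>2) (p\<^sup>2) n" for n
    by (induction n) (simp_all add: qpoch_Suc algebra_simps power2_eq_square power_mult_distrib)
  moreover have "(\<lambda>n. qpoch a p n * qpoch (- a) p n) \<longlonglongrightarrow> qpoch_inf a p * qpoch_inf (- a) p"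
    by (intro tendsto_intros qpoch_tendsto assms)
  moreover have "norm (p\<^sup>2) < 1"
    using assms by (simp add: norm_power power_less_one_iff)
  then have "(\<lambda>n. qpoch (a\<^sup>2) (p\<^sup>2) n) \<longlonglongrightarrow> qpoch_inf (a\<^sup>2) (p\<^sup>2)"
    by (rule qpoch_tendsto)
  ultimately show ?thesis
    using LIMSEQ_unique by auto
qed

lemma qpoch_inf_bisect:
  assumes "norm p < 1"
  shows "qpoch_inf a p = qpoch_inf a (p\<^sup>2) * qpoch_inf (a * p) (p\<^sup>2)"
proof (rule LIMSEQ_unique)
  have "qpoch a p (2 * n) = qpoch a (p\<^sup>2) n * qpoch (a * p) (p\<^sup>2) n" for n
    by (induction n) (simp_all add: qpoch_Suc mult_ac flip: power_mult)
  moreover have "norm (p\<^sup>2) < 1"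
    using assms by (simp add: norm_power power_less_one_iff)
  ultimately show "(\<lambda>n. qpoch a p (2 * n)) \<longlonglongrightarrow> qpoch_inf a (p\<^sup>2) * qpoch_inf (a * p) (p\<^sup>2)"
    by (simp only:) (intro tendsto_intros qpoch_tendsto)
  show "(\<lambda>n. qpoch a p (2 * n)) \<longlonglongrightarrow> qpoch_inf a p"
    using LIMSEQ_subseq_LIMSEQ[OF qpoch_tendsto[OF assms], of "\<lambda>n. 2 * n" a]
    by (simp add: o_def strict_mono_def)
qed

lemma qpoch_inf_self_nonzero:
  assumes "norm p < 1"
  shows "qpoch_inf p p \<noteq> 0"
  by (intro qpoch_inf_nonzero mult_power_neq_1_complex assms)

text \<open>Euler's identity between partitions into distinct and into odd parts. Multiplying by
  \<open>(p^2;p^2)_inf\<close> completes \<open>(p;p^2)_inf\<close> to \<open>(p;p)_inf\<close>, and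
  \<open>(p;p)_inf (-p;p)_inf\<close> is \<open>(p^2;p^2)_inf\<close> again.\<close>

lemma euler_odd_distinct:
  assumes "norm p < 1"
  shows "qpoch_inf (- p) p * qpoch_inf p (p\<^sup>2) = 1"
proof -
  have "qpoch_inf (p\<^sup>2) (p\<^sup>2) \<noteq> 0"
    using assms by (intro qpoch_inf_self_nonzero) (simp add: norm_power power_less_one_iff)
  moreover have "qpoch_inf (p\<^sup>2) (p\<^sup>2) * (qpoch_inf (- p) p * qpoch_inf p (p\<^sup>2))
      = qpoch_inf (p\<^sup>2) (p\<^sup>2) * 1"
    using qpoch_inf_bisect[OF assms, of p] qpoch_inf_mult_uminus[OF assms, of p]
    by (simp add: power2_eq_square mult_ac)
  ultimately show ?thesis
    using mult_left_cancel by blast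
qed

section \<open>The Bailey pairs\<close>

locale nome =
  fixes q :: complex
  assumes q_pos: "0 < norm q" and q_less_1: "norm q < 1"
begin

lemma q_nonzero [simp]: "q \<noteq> 0"
  using q_pos by auto

lemma norm_power_q: "0 < k \<Longrightarrow> norm (q ^ k) < 1"
  using q_less_1 by (simp add: norm_power power_less_one_iff)

lemma norm_q2: "norm (q\<^sup>2) < 1"
  by (rule norm_power_q) simp

lemma power_q_mult_neq_1: "0 < j \<Longrightarrow> q ^ j * (q ^ i) ^ k \<noteq> 1"
  using power_neq_1_complex[OF q_less_1, of "j + i * k"] by (simp add: power_add power_mult)

lemma uminus_q_mult_neq_1: "- q * (q\<^sup>2) ^ k \<noteq> 1"
proof
  assume "- q * (q\<^sup>2) ^ k = 1"
  then have "(- q * (q\<^sup>2) ^ k)\<^sup>2 = 1" by simp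
  moreover have "(- q * (q\<^sup>2) ^ k)\<^sup>2 = q ^ (2 + 4 * k)"
    by (simp add: power_mult_distrib flip: power_mult power_add)
  ultimately show False
    using power_neq_1_complex[OF q_less_1, of "2 + 4 * k"] by simp
qed

lemma power_int_q_collect:
  "(q ^ k) powi a * (s * q powi b) = s * q powi (int k * a + b)"
  "q ^ k * (s * q powi b) = s * q powi (int k + b)"
  by (simp_all add: power_int_add power_int_mult)

text \<open>The exponents are \<open>(3r^2 - r)/2\<close>, \<open>(3r^2 + r)/2\<close> and
  \<open>3r(r + 1)/2\<close> for \<open>s = 1, 2, 3\<close>. These sequences are not eigenvectors of
  the weighted shifts, but the shifts move \<open>s\<close> within the family and reflections relate
  its members.\<close>

definition theta3 :: "int \<Rightarrow> int \<Rightarrow> complex" where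
  "theta3 s r = (- 1) powi r * q powi (3 * tri r + s * r)"

lemma theta3_uminus: "theta3 s (- r) = theta3 (3 - s) r"
proof -
  have "3 * tri (- r) + s * (- r) = 3 * tri r + (3 - s) * r"
    by (simp add: tri_uminus algebra_simps)
  then show ?thesis
    unfolding theta3_def by (simp add: power_int_minus_one_minus)
qed

lemma theta3_3_reflect: "theta3 3 (- r - 1) = - theta3 3 r"
proof -
  have e: "3 * tri (- r - 1) + 3 * (- r - 1) = 3 * tri r + 3 * r"
    by (simp add: tri_reflect algebra_simps)
  have "(- 1 :: complex) powi (- r - 1) = - ((- 1) powi r)"
    by (simp add: power_int_diff power_int_minus_one_minus)
  then show ?thesis
    unfolding theta3_def e by simp
qed

lemma theta3_pred: "(q\<^sup>2) powi (int n + r) * theta3 2 (r - 1) = - (q ^ (2 * n + 1)) * theta3 1 r"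
proof -
  have e: "int 2 * (int n + r) + (3 * tri (r - 1) + 2 * (r - 1)) = int (2 * n + 1) + (3 * tri r + 1 * r)"
    by (simp add: tri_minus_1 algebra_simps)
  show ?thesis
    unfolding theta3_def minus_mult_left[symmetric] power_int_q_collect e by (simp add: power_int_diff)
qed

lemma theta3_succ: "(q\<^sup>2) powi (int n - r) * theta3 s (r + 1)
    = - (q powi (2 * int n + s)) * theta3 (s + 1) r"
proof -
  have e: "int 2 * (int n - r) + (3 * tri (r + 1) + s * (r + 1))
      = (2 * int n + s) + (3 * tri r + (s + 1) * r)"
    by (simp add: tri_plus_1 algebra_simps)
  show ?thesis
    unfolding theta3_def power_int_q_collect e
    by (simp add: power_int_add)
qed

lemma bsum_theta3_1: "bsum (q\<^sup>2) 0 n (theta3 1) = bsum (q\<^sup>2) 0 n (theta3 2)"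
  using bsum_reflect[of "q\<^sup>2" 0 n "theta3 2"] by (simp add: theta3_uminus)

text \<open>The shift turns \<open>theta3 2\<close> into \<open>theta3 1\<close>, which by
  reflection has the same sum at width 0. The base being \<open>q^2\<close>, the factor
  \<open>1 - q^(2n+1)\<close> cancels from \<open>1 - q^(4n+2)\<close> and leaves the next factor of
  \<open>(-q;q^2)\<close>.\<close>

lemma bsum_theta3_width:
  "(1 + q ^ (2 * n + 1)) * bsum (q\<^sup>2) 1 n (theta3 2) = bsum (q\<^sup>2) 0 n (theta3 2)"
proof -
  have "(1 - (q\<^sup>2) ^ (2 * n + 1)) * bsum (q\<^sup>2) 1 n (theta3 2)
      = (1 - q ^ (2 * n + 1)) * bsum (q\<^sup>2) 0 n (theta3 2)"
    using norm_q2 unfolding bsum_Suc_width[OF norm_q2 power_not_zero[OF q_nonzero]] theta3_pred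
      bsum_add bsum_cmult bsum_theta3_1
    by (simp add: algebra_simps)
  moreover have "1 - (q\<^sup>2) ^ (2 * n + 1) = (1 - q ^ (2 * n + 1)) * (1 + q ^ (2 * n + 1))"
    by (simp add: algebra_simps flip: power_mult power_add)
  ultimately have "(1 - q ^ (2 * n + 1)) * ((1 + q ^ (2 * n + 1)) * bsum (q\<^sup>2) 1 n (theta3 2))
      = (1 - q ^ (2 * n + 1)) * bsum (q\<^sup>2) 0 n (theta3 2)"
    by (simp only: mult.assoc)
  then show ?thesis
    using one_minus_power_nonzero[OF q_less_1, of "2 * n + 1"] by (simp only: mult_cancel_left) simp
qed

text \<open>The shifted part is a multiple of the sum of \<open>theta3 3\<close>, which changes sign
  under the reflection \<open>r \<mapsto> - r - 1\<close> of width 1 and therefore vanishes.\<close>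

lemma bsum_theta3_index:
  "(1 - (q\<^sup>2) ^ (2 * n + 2)) * bsum (q\<^sup>2) 0 (Suc n) (theta3 2) = bsum (q\<^sup>2) 1 n (theta3 2)"
proof -
  have "bsum (q\<^sup>2) 1 n (theta3 3) = - bsum (q\<^sup>2) 1 n (theta3 3)"
    using bsum_reflect[of "q\<^sup>2" 1 n "theta3 3"] bsum_cmult[of "q\<^sup>2" 1 n "-1" "theta3 3"]
    by (simp add: theta3_3_reflect)
  then have "bsum (q\<^sup>2) 1 n (theta3 3) = 0" by simp
  then show ?thesis
    unfolding bsum_Suc_index[OF norm_q2 power_not_zero[OF q_nonzero]] theta3_succ bsum_add bsum_cmult
    by simp
qed

text \<open>The step in \<open>n\<close> takes \<open>theta3 1\<close> to \<open>theta3 2\<close>.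
  As their sums agree at width 0, at width 1 the sum of \<open>theta3 1\<close> is
  \<open>1 + q^(2n+1)\<close> times that of \<open>theta3 2\<close>, which undoes the step in
  width.\<close>

lemma bsum_theta3_width_1: "bsum (q\<^sup>2) 1 n (theta3 1) = bsum (q\<^sup>2) 0 n (theta3 2)"
proof -
  have "(1 - (q\<^sup>2) ^ (2 * n + 2)) * bsum (q\<^sup>2) 0 (Suc n) (theta3 1)
     = bsum (q\<^sup>2) 1 n (theta3 1) - q powi (2 * int n + 1) * bsum (q\<^sup>2) 1 n (theta3 2)"
    unfolding bsum_Suc_index[OF norm_q2 power_not_zero[OF q_nonzero]] theta3_succ bsum_add bsum_cmult
    by simp
  moreover have "q powi (2 * int n + 1) = q ^ (2 * n + 1)"
    using power_int_of_nat[of q "2 * n + 1"] by (simp add: add.commute)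
  ultimately show ?thesis
    unfolding bsum_theta3_1 bsum_theta3_index using bsum_theta3_width[of n]
    by (simp add: algebra_simps)
qed

abbreviation "den n e \<equiv> qpoch (- q) (q\<^sup>2) (n + e) * qpoch (q ^ 4) (q ^ 4) n"

lemma den_nonzero: "den n e \<noteq> 0"
proof -
  have "qpoch (- q) (q\<^sup>2) (n + e) \<noteq> 0"
    by (rule qpoch_nonzero) (rule uminus_q_mult_neq_1)
  moreover have "qpoch (q ^ 4) (q ^ 4) n \<noteq> 0"
    by (rule qpoch_self_nonzero) (simp add: norm_power_q)
  ultimately show ?thesis by simp
qed

lemma uminus_q_qpoch_Suc: "qpoch (- q) (q\<^sup>2) (Suc n) = (1 + q ^ (2 * n + 1)) * qpoch (- q) (q\<^sup>2) n"
  by (simp add: qpoch_Suc power_mult)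

text \<open>The step in width contributes \<open>1 + q^(2n+1)\<close> and the step in
  \<open>n\<close> contributes \<open>1 - q^(4n+4)\<close>: together these build up
  \<open>den\<close>.\<close>

lemma bailey_pair_0: "bsum (q\<^sup>2) 0 n (theta3 2) = 1 / den n 0"
  and bailey_pair_1: "bsum (q\<^sup>2) 1 n (theta3 2) = 1 / den n 1"
proof -
  have step: "bsum (q\<^sup>2) 0 n (theta3 2) * den n 0 = 1 \<Longrightarrow> bsum (q\<^sup>2) 1 n (theta3 2) * den n 1 = 1" for n
    unfolding bsum_theta3_width[symmetric] by (simp add: uminus_q_qpoch_Suc mult_ac)
  have 0: "bsum (q\<^sup>2) 0 n (theta3 2) * den n 0 = 1" for n
  proof (induction n)
    case 0
    show ?case by (simp add: bsum_0_0 theta3_def tri_def)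
  next
    case (Suc n)
    have "q ^ 4 * (q ^ 4) ^ n = q ^ (4 + 4 * n)"
      by (simp only: power_add power_mult)
    also have "4 + 4 * n = 2 * (2 * n + 2)" by simp
    finally have d: "den (Suc n) 0 = den n 1 * (1 - (q\<^sup>2) ^ (2 * n + 2))"
      by (simp only: qpoch_Suc[of "q ^ 4"] power_mult) simp
    show ?case
      unfolding d using step[OF Suc] unfolding bsum_theta3_index[symmetric] by (simp only: mult_ac)
  qed
  show "bsum (q\<^sup>2) 0 n (theta3 2) = 1 / den n 0"
    using 0[of n] den_nonzero[of n 0] by (simp only: eq_divide_eq) simp
  show "bsum (q\<^sup>2) 1 n (theta3 2) = 1 / den n 1"
    using step[OF 0[of n]] den_nonzero[of n 1] by (simp only: eq_divide_eq) simp
qed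

text \<open>Pairing \<open>den n 0\<close> with width 1 gives access to \<open>moment 0 1\<close>,
  since the weight with \<open>m = 1\<close> calls for width 1.\<close>

lemma bailey_pair_1': "bsum (q\<^sup>2) 1 n (theta3 1) = 1 / den n 0"
  unfolding bsum_theta3_width_1 bailey_pair_0 ..

section \<open>Conjugate Bailey pairs and the three initial values\<close>

definition weight :: "nat \<Rightarrow> nat \<Rightarrow> complex" where
  "weight m n = (- 1) ^ n * qpoch q (q\<^sup>2) n * q ^ (n\<^sup>2 + 2 * m * n)"

lemma weight_bound:
  obtains C where "0 < C" "\<And>m n. norm (weight m n) \<le> C * norm q ^ n"
proof -
  obtain C where C: "0 < C" "\<And>n. norm (qpoch q (q\<^sup>2) n) \<le> C"
    using qpoch_bounded[OF norm_q2, where a = q] by blast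
  have "norm (weight m n) \<le> C * norm q ^ n" for m n
  proof -
    have "norm q ^ (n\<^sup>2 + 2 * m * n) \<le> norm q ^ n"
      using q_less_1 by (intro power_decreasing) (auto simp: power2_eq_square intro: trans_le_add1)
    then show ?thesis
      using C by (simp add: weight_def norm_mult norm_power mult_mono less_imp_le)
  qed
  then show ?thesis using C(1) that by blast
qed

lemma summable_weight: "summable (\<lambda>n. norm (weight m n))"
proof -
  obtain C where C: "0 < C" "\<And>m n. norm (weight m n) \<le> C * norm q ^ n"
    using weight_bound by blast
  show ?thesis
  proof (rule summable_comparison_test')
    show "summable (\<lambda>n. C * norm q ^ n)"
      using q_less_1 by (intro summable_mult summable_geometric) simp
    show "norm (norm (weight m n)) \<le> C * norm q ^ n" for n
      using C(2)[of m n] by simp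
  qed
qed

text \<open>With \<open>n = k + r\<close> this is a \<open>1phi1\<close> in base \<open>q^2\<close>
  with \<open>a = q^(2r+1)\<close> and \<open>z = q^(2r+1+2e)\<close>. Then
  \<open>a z = q^(4r+2+2e)\<close> is where \<open>(q^2;q^2)_{2r+e+k}\<close> continues after its
  first \<open>2r+e\<close> factors; this match is the reason for tying the weight to
  \<open>e\<close>.\<close>

lemma conjugate_bailey_nat:
  "(\<lambda>n. weight e n * (inv_qfact (q\<^sup>2) (int n - int r) * inv_qfact (q\<^sup>2) (int n + int r + int e))) sums
    ((- 1) ^ r * q ^ (r\<^sup>2 + 2 * e * r) * qpoch q (q\<^sup>2) r * qpoch_inf (q ^ (2 * r + 1 + 2 * e)) (q\<^sup>2)
      / qpoch_inf (q\<^sup>2) (q\<^sup>2))"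
    (is "?f sums ?S")
proof -
  let ?a = "q ^ (2 * r + 1)" and ?z = "q ^ (2 * r + 1 + 2 * e)"
  \<comment> \<open>\<open>c\<close> is the term of the series at \<open>k = 0\<close>, by which the
    \<open>1phi1\<close> has to be scaled.\<close>
  define c where "c = (- 1) ^ r * q ^ (r\<^sup>2 + 2 * e * r) * qpoch q (q\<^sup>2) r / qpoch (q\<^sup>2) (q\<^sup>2) (2 * r + e)"
  have az: "?a * ?z = q\<^sup>2 * (q\<^sup>2) ^ (2 * r + e)"
    by (simp flip: power_mult power_add power_Suc)
  have "?a * ?z * (q\<^sup>2) ^ k \<noteq> 1" for k
    using power_q_mult_neq_1[of "4 * r + 2 + 2 * e" 2 k] by (simp flip: power_add add: algebra_simps)
  then have "phi11_term ?a (q\<^sup>2) ?z sums (qpoch_inf ?z (q\<^sup>2) / qpoch_inf (?a * ?z) (q\<^sup>2))"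
    using phi11_sum[OF norm_q2] by blast
  then have "(\<lambda>k. c * phi11_term ?a (q\<^sup>2) ?z k) sums (c * (qpoch_inf ?z (q\<^sup>2) / qpoch_inf (?a * ?z) (q\<^sup>2)))"
    by (rule sums_mult)
  also have "c * (qpoch_inf ?z (q\<^sup>2) / qpoch_inf (?a * ?z) (q\<^sup>2)) = ?S"
    unfolding az qpoch_inf_split[OF norm_q2, of "q\<^sup>2" "2 * r + e"] by (simp add: c_def)
  also have "(\<lambda>k. c * phi11_term ?a (q\<^sup>2) ?z k) = (\<lambda>k. ?f (k + r))"
  proof
    fix k
    have "(k + r)\<^sup>2 + 2 * e * (k + r) = (r\<^sup>2 + 2 * e * r) + ((2 * r + 1 + 2 * e) * k + 2 * (k choose 2))"
      using two_choose_two[of k] by (simp add: power2_eq_square algebra_simps)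
    then have e1: "q ^ ((k + r)\<^sup>2 + 2 * e * (k + r))
        = q ^ (r\<^sup>2 + 2 * e * r) * (?z ^ k * (q\<^sup>2) ^ (k choose 2))"
      by (simp only: power_add power_mult)
    have e2: "qpoch q (q\<^sup>2) (k + r) = qpoch q (q\<^sup>2) r * qpoch ?a (q\<^sup>2) k"
      unfolding add.commute[of k] qpoch_add by (simp add: power_mult)
    have e3: "inv_qfact (q\<^sup>2) (int (k + r) - int r) = inverse (qpoch (q\<^sup>2) (q\<^sup>2) k)"
      by (simp add: inv_qfact_def)
    have "nat (int (k + r) + int r + int e) = (2 * r + e) + k" by simp
    then have e4: "inv_qfact (q\<^sup>2) (int (k + r) + int r + int e)
        = inverse (qpoch (q\<^sup>2) (q\<^sup>2) (2 * r + e) * qpoch (?a * ?z) (q\<^sup>2) k)"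
      unfolding az qpoch_add[symmetric] by (simp only: inv_qfact_def) simp
    have e5: "(- ?z) ^ k = (- 1) ^ k * ?z ^ k"
      by (rule power_minus)
    show "c * phi11_term ?a (q\<^sup>2) ?z k = ?f (k + r)"
      unfolding weight_def e1 e2 e3 e4 e5 c_def phi11_term_def
      by (simp only: divide_inverse inverse_mult_distrib power_add mult_ac)
  qed
  finally have "(\<lambda>k. ?f (k + r)) sums ?S" .
  moreover have "?f n = 0" if "n < r" for n
    using that by (simp add: inv_qfact_def)
  ultimately show ?thesis
    by (subst (asm) sums_zero_iff_shift) auto
qed

definition \<kappa> :: complex where
  "\<kappa> = qpoch_inf q (q\<^sup>2) / qpoch_inf (q\<^sup>2) (q\<^sup>2)"

lemma q_powi_odd_neq_1: "q powi (2 * r + 1) \<noteq> 1"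
proof (cases r)
  case (nonneg n)
  then have "q powi (2 * r + 1) = q ^ (2 * n + 1)"
    using power_int_of_nat[of q "2 * n + 1"] by (simp add: add.commute)
  then show ?thesis
    using power_neq_1_complex[OF q_less_1, of "2 * n + 1"] by simp
next
  case (neg n)
  then have "2 * r + 1 = - int (2 * n + 1)" by simp
  then have "q powi (2 * r + 1) = inverse (q ^ (2 * n + 1))"
    by (simp only: power_int_minus power_int_of_nat)
  then show ?thesis
    using power_neq_1_complex[OF q_less_1, of "2 * n + 1"] by (simp only: inverse_eq_1_iff) simp
qed

definition \<delta>0 :: "int \<Rightarrow> complex" where
  "\<delta>0 r = (- 1) powi r * q powi (2 * tri r + r) * \<kappa>"

text \<open>The exponent is \<open>r^2 + 2r\<close>. The denominator is the factor that
  \<open>(q;q^2)_r (q^(2r+3);q^2)_inf\<close> lacks from \<open>(q;q^2)_inf\<close>.\<close>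

definition \<delta>1 :: "int \<Rightarrow> complex" where
  "\<delta>1 r = (- 1) powi r * q powi (2 * tri r + 3 * r) / (1 - q powi (2 * r + 1)) * \<kappa>"

lemma \<delta>0_uminus: "\<delta>0 (- r) = \<delta>0 r"
proof -
  have e: "2 * tri (- r) + - r = 2 * tri r + r"
    by (simp add: tri_uminus)
  show ?thesis
    unfolding \<delta>0_def e by (simp add: power_int_minus_one_minus)
qed

text \<open>With \<open>u = q^(2r+1)\<close>, reflection turns \<open>1 - u\<close> into
  \<open>1 - 1/u = - (1 - u) / u\<close>. The sign cancels against that of
  \<open>(-1)^(-r-1)\<close>, and \<open>u\<close> against the change of the exponent.\<close>

lemma \<delta>1_reflect: "\<delta>1 (- r - 1) = \<delta>1 r"
proof -
  have e1: "2 * tri (- r - 1) + 3 * (- r - 1) = (2 * tri r + 3 * r) + - (2 * r + 1)"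
    by (simp add: tri_reflect)
  have e2: "2 * (- r - 1) + 1 = - (2 * r + 1)"
    by simp
  have e3: "(- 1 :: complex) powi (- r - 1) = - ((- 1) powi r)"
    by (simp add: power_int_diff power_int_minus_one_minus)
  have "q powi (2 * r + 1) \<noteq> 0" by simp
  moreover note q_powi_odd_neq_1[of r]
  ultimately have "- s * (X * inverse (q powi (2 * r + 1))) / (1 - inverse (q powi (2 * r + 1)))
      = s * X / (1 - q powi (2 * r + 1))" for s X
    by (simp add: divide_simps) (simp add: algebra_simps)
  then show ?thesis
    unfolding \<delta>1_def e1 e2 e3 power_int_add[OF disjI1[OF q_nonzero]] power_int_minus by simp
qed

text \<open>The \<open>1phi1\<close> covers \<open>r \<ge> 0\<close>; for negative \<open>r\<close>,
  the kernel and \<open>\<delta>0\<close> are invariant under the same reflection.\<close>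

lemma conjugate_bailey_0:
  "(\<lambda>n. weight 0 n * (inv_qfact (q\<^sup>2) (int n - r) * inv_qfact (q\<^sup>2) (int n + r + int 0))) sums \<delta>0 r"
proof -
  have nat: "(\<lambda>n. weight 0 n * (inv_qfact (q\<^sup>2) (int n - int s) * inv_qfact (q\<^sup>2) (int n + int s + int 0)))
      sums \<delta>0 (int s)" for s
  proof -
    have e: "2 * tri (int s) + int s = int (s\<^sup>2 + 2 * 0 * s)"
      using arg_cong[OF two_choose_two[of s], of int] by (simp add: tri_of_nat)
    have "qpoch_inf q (q\<^sup>2) = qpoch q (q\<^sup>2) s * qpoch_inf (q ^ (2 * s + 1 + 2 * 0)) (q\<^sup>2)"
      unfolding qpoch_inf_split[OF norm_q2, of q s] by (simp add: power_mult)
    then show ?thesis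
      using conjugate_bailey_nat[of 0 s] unfolding \<delta>0_def \<kappa>_def e power_int_of_nat by (simp add: mult_ac)
  qed
  show ?thesis
  proof (cases r rule: int_cases2)
    case (nonpos s)
    then show ?thesis
      using nat[of s] by (simp add: \<delta>0_uminus mult_ac)
  qed (use nat in simp)
qed

lemma conjugate_bailey_1:
  "(\<lambda>n. weight 1 n * (inv_qfact (q\<^sup>2) (int n - r) * inv_qfact (q\<^sup>2) (int n + r + int 1))) sums \<delta>1 r"
proof -
  have nat: "(\<lambda>n. weight 1 n * (inv_qfact (q\<^sup>2) (int n - int s) * inv_qfact (q\<^sup>2) (int n + int s + int 1)))
      sums \<delta>1 (int s)" for s
  proof -
    have "2 * tri (int s) + 3 * int s = int (s\<^sup>2 + 2 * 1 * s)"
      using arg_cong[OF two_choose_two[of s], of int] by (simp add: tri_of_nat)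
    then have e: "q powi (2 * tri (int s) + 3 * int s) = q ^ (s\<^sup>2 + 2 * 1 * s)"
      by (simp only: power_int_of_nat)
    have e': "q powi (2 * int s + 1) = q ^ (2 * s + 1)"
      using power_int_of_nat[of q "2 * s + 1"] by (simp add: add.commute)
    have nz: "1 - q ^ (2 * s + 1) \<noteq> 0"
      using one_minus_power_nonzero[OF q_less_1, of "2 * s + 1"] by simp
    have "qpoch_inf q (q\<^sup>2)
        = qpoch q (q\<^sup>2) s * (1 - q ^ (2 * s + 1)) * qpoch_inf (q ^ (2 * s + 1 + 2 * 1)) (q\<^sup>2)"
    proof -
      have "q * (q\<^sup>2) ^ s = q ^ (2 * s + 1)" "q * (q\<^sup>2) ^ Suc s = q ^ (2 * s + 1 + 2 * 1)"
        by (simp_all add: power_mult power_add power2_eq_square power3_eq_cube)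
      then show ?thesis
        using qpoch_inf_split[OF norm_q2, of q "Suc s"] by (simp only: qpoch_Suc)
    qed
    then have k: "\<kappa> = qpoch q (q\<^sup>2) s * (1 - q ^ (2 * s + 1)) * qpoch_inf (q ^ (2 * s + 1 + 2 * 1)) (q\<^sup>2)
        / qpoch_inf (q\<^sup>2) (q\<^sup>2)"
      unfolding \<kappa>_def by simp
    have cancel: "A * X / (1 - q ^ (2 * s + 1)) * (B * (1 - q ^ (2 * s + 1)) * Y / Z) = A * X * B * Y / Z"
      for A X B Y Z
      using nz by simp
    show ?thesis
      unfolding \<delta>1_def k e e' power_int_of_nat cancel by (rule conjugate_bailey_nat)
  qed
  show ?thesis
  proof (cases r rule: int_cases)
    case (neg s)
    then have r: "r = - int s - 1" by simp
    show ?thesis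
      using nat[of s] unfolding r \<delta>1_reflect by (simp add: algebra_simps)
  qed (use nat in simp)
qed

section \<open>Theta series and the three initial moments\<close>

lemma summable_theta3: "(\<lambda>r. norm (theta3 s r)) summable_on UNIV"
proof -
  have "(q ^ 3) powi tri r * (q powi s) powi r = q powi (3 * tri r + s * r)" for r
    by (simp add: power_int_add power_int_mult)
  then have "norm (theta3 s r) = norm ((q ^ 3) powi tri r * (q powi s) powi r)" for r
    by (simp add: theta3_def norm_mult norm_power_int)
  then show ?thesis
    using abs_summable_theta[OF norm_power_q, of 3 "q powi s"] by simp
qed

lemma theta5_has_sum:
  "((\<lambda>r. q powi (5 * tri r + int k * r)) has_sum
    (qpoch_inf (- (q ^ k)) (q ^ 5) * qpoch_inf (- (q ^ 5) / q ^ k) (q ^ 5) * qpoch_inf (q ^ 5) (q ^ 5))) UNIV"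
proof -
  have "(q ^ 5) powi tri r * (q ^ k) powi r = q powi (5 * tri r + int k * r)" for r
    by (simp add: power_int_add power_int_mult)
  then show ?thesis
    using jacobi_triple_product[OF norm_power_q, of 5 "q ^ k"] by simp
qed

definition moment :: "nat \<Rightarrow> nat \<Rightarrow> complex" where
  "moment e m = (\<Sum>n. weight m n / den n e)"

definition value_P :: complex where
  "value_P = \<kappa> * (qpoch_inf (- (q\<^sup>2)) (q ^ 5) * qpoch_inf (- (q ^ 3)) (q ^ 5) * qpoch_inf (q ^ 5) (q ^ 5))"

definition value_R :: complex where
  "value_R = \<kappa> * (qpoch_inf (- q) (q ^ 5) * qpoch_inf (- (q ^ 4)) (q ^ 5) * qpoch_inf (q ^ 5) (q ^ 5))"

lemma neg_one_powi_square: "((- 1) powi r * x) * ((- 1) powi r * y) = x * (y :: complex)"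
proof -
  have "(- 1 :: complex) powi r * (- 1) powi r = 1"
    by (metis power_int_minus_one_mult_self)
  then show ?thesis
    by (metis mult.left_commute mult.assoc mult_1)
qed

text \<open>The signs of \<open>theta3 2\<close> and \<open>\<delta>0\<close> cancel and the
  exponents add up to \<open>5 * tri r + 3 * r\<close>, the theta series at base \<open>q^5\<close>
  with \<open>z = q^3\<close>.\<close>

lemma moment_0_0: "moment 0 0 = value_P"
proof -
  have "theta3 2 r * \<delta>0 r = \<kappa> * q powi (5 * tri r + int 3 * r)" for r
  proof -
    have "q powi (3 * tri r + 2 * r) * q powi (2 * tri r + r) = q powi (5 * tri r + int 3 * r)"
      by (subst power_int_add[symmetric]) (auto simp: algebra_simps)
    then show ?thesis
      unfolding theta3_def \<delta>0_def mult.assoc[symmetric] by (simp add: neg_one_powi_square mult_ac)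
  qed
  then have "(\<Sum>\<^sub>\<infinity>r. theta3 2 r * \<delta>0 r) = \<kappa> * (\<Sum>\<^sub>\<infinity>r. q powi (5 * tri r + int 3 * r))"
    by (simp only: infsum_cmult_right')
  also have "\<dots> = value_P"
    unfolding infsumI[OF theta5_has_sum] value_P_def by (simp add: power_diff[symmetric] mult_ac)
  finally show ?thesis
    using bailey_sums[OF norm_q2 summable_weight summable_theta3 conjugate_bailey_0, of 2]
    unfolding moment_def bailey_pair_0 by (simp add: sums_iff)
qed

lemma infsum_int_reflect: "(\<Sum>\<^sub>\<infinity>r::int. f (- r - 1)) = (\<Sum>\<^sub>\<infinity>r. f r :: complex)"
  by (rule infsum_reindex_bij_witness[of _ "\<lambda>r. - r - 1" "\<lambda>r. - r - 1"]) auto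

lemma two_infsum_int_reflect:
  fixes f :: "int \<Rightarrow> complex"
  assumes "f summable_on UNIV"
  shows "2 * infsum f UNIV = (\<Sum>\<^sub>\<infinity>r. f r + f (- r - 1))"
proof -
  have "(\<lambda>r. f (- r - 1)) summable_on UNIV"
    using assms
    by (subst summable_on_reindex_bij_witness[of _ "\<lambda>r. - r - 1" "\<lambda>r. - r - 1" UNIV f]) auto
  then show ?thesis
    using assms by (simp add: infsum_add infsum_int_reflect)
qed

lemma theta3_\<delta>1: "theta3 s r * \<delta>1 r = \<kappa> * (q powi (5 * tri r + (s + 3) * r) / (1 - q powi (2 * r + 1)))"
proof -
  have a: "q powi (3 * tri r + s * r) * q powi (2 * tri r + 3 * r) = q powi (5 * tri r + (s + 3) * r)"
    by (subst power_int_add[symmetric]) (auto simp: algebra_simps)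
  have b: "((- 1 :: complex) powi r * X) * ((- 1) powi r * Y / Z * K) = K * (X * Y / Z)" for X Y Z K
    using neg_one_powi_square[of r X "Y / Z * K"] by simp
  show ?thesis
    unfolding theta3_def \<delta>1_def a b ..
qed

text \<open>With \<open>u = q^(2r+1)\<close>, reflection turns \<open>1 / (1 - u)\<close> into
  \<open>- u / (1 - u)\<close>, and \<open>u\<close> is absorbed into the exponent. Both halves of
  an averaged sum thus share a denominator.\<close>

lemma theta3_\<delta>1_reflect:
  "q powi (5 * tri (- r - 1) + c * (- r - 1)) / (1 - q powi (2 * (- r - 1) + 1))
    = - (q powi (5 * tri r + (12 - c) * r + 6 - c)) / (1 - q powi (2 * r + 1))"
proof -
  have "5 * tri (- r - 1) + c * (- r - 1) = (5 * tri r + (12 - c) * r + 6 - c) - (2 * r + 1)"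
    by (simp add: tri_reflect algebra_simps)
  then have e1: "q powi (5 * tri (- r - 1) + c * (- r - 1))
      = q powi (5 * tri r + (12 - c) * r + 6 - c) / q powi (2 * r + 1)"
    by (simp only: power_int_diff[OF disjI1[OF q_nonzero]])
  have "2 * (- r - 1) + 1 = - (2 * r + 1)" by simp
  then have e2: "q powi (2 * (- r - 1) + 1) = inverse (q powi (2 * r + 1))"
    by (simp only: power_int_minus)
  have "X / u / (1 - inverse u) = - X / (1 - u)" if "u \<noteq> 0" "u \<noteq> 1" for X u :: complex
    using that by (simp add: divide_simps) (simp add: algebra_simps)
  then show ?thesis
    unfolding e1 e2 using q_powi_odd_neq_1[of r] by simp
qed

text \<open>
  Averaging over the reflection \<open>r \<mapsto> - r - 1\<close> produces numerators divisible by \<open>1 - q^(2r+1)\<close>.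
\<close>

lemma two_moment_1:
  assumes "\<And>n. bsum (q\<^sup>2) 1 n (theta3 s) = 1 / den n e"
  shows "2 * moment e 1 = \<kappa> * (\<Sum>\<^sub>\<infinity>r.
    (q powi (5 * tri r + (s + 3) * r) - q powi (5 * tri r + (9 - s) * r + 3 - s)) / (1 - q powi (2 * r + 1)))"
proof -
  have "moment e 1 = (\<Sum>\<^sub>\<infinity>r. theta3 s r * \<delta>1 r)"
    using bailey_sums[OF norm_q2 summable_weight summable_theta3 conjugate_bailey_1, of s]
    unfolding moment_def assms by (simp add: sums_iff)
  then have "2 * moment e 1 = (\<Sum>\<^sub>\<infinity>r. theta3 s r * \<delta>1 r + theta3 s (- r - 1) * \<delta>1 (- r - 1))"
    using two_infsum_int_reflect[OF bailey_summable[OF norm_q2 summable_weight summable_theta3 conjugate_bailey_1, of s]]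
    by simp
  also have "\<dots> = (\<Sum>\<^sub>\<infinity>r. \<kappa> * ((q powi (5 * tri r + (s + 3) * r) - q powi (5 * tri r + (9 - s) * r + 3 - s))
      / (1 - q powi (2 * r + 1))))"
  proof (rule infsum_cong)
    fix r
    have "12 - (s + 3) = 9 - s" "5 * tri r + (9 - s) * r + 6 - (s + 3) = 5 * tri r + (9 - s) * r + 3 - s"
      by simp_all
    then show "theta3 s r * \<delta>1 r + theta3 s (- r - 1) * \<delta>1 (- r - 1)
       = \<kappa> * ((q powi (5 * tri r + (s + 3) * r) - q powi (5 * tri r + (9 - s) * r + 3 - s)) / (1 - q powi (2 * r + 1)))"
      unfolding theta3_\<delta>1 theta3_\<delta>1_reflect by (simp only: diff_divide_distrib right_diff_distrib) simp
  qed
  finally show ?thesis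
    by (simp only: infsum_cmult_right')
qed

text \<open>With \<open>u = q^(2r+1)\<close> the averaged numerator is \<open>X (1 - u^2)\<close>.
  Division leaves \<open>X + X u\<close>, where \<open>X u\<close> is \<open>X\<close> at
  \<open>-r-1\<close>, so the sum is twice one theta series.\<close>

lemma moment_0_1: "moment 0 1 = value_R"
proof -
  have "(q powi (5 * tri r + (1 + 3) * r) - q powi (5 * tri r + (9 - 1) * r + 3 - 1)) / (1 - q powi (2 * r + 1))
     = q powi (5 * tri r + int 4 * r) + q powi (5 * tri (- r - 1) + int 4 * (- r - 1))" for r
  proof -
    have e1: "5 * tri (- r - 1) + int 4 * (- r - 1) = (5 * tri r + int 4 * r) + (2 * r + 1)"
      by (simp add: tri_reflect)
    have e2: "5 * tri r + (9 - 1) * r + 3 - 1 = (5 * tri r + int 4 * r) + (2 * r + 1) + (2 * r + 1)"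
      by simp
    have e3: "5 * tri r + (1 + 3) * r = 5 * tri r + int 4 * r" by simp
    have "(X - X * u * u) / (1 - u) = X + X * u" if "u \<noteq> 1" for X u :: complex
      using that by (simp add: divide_simps) (simp add: algebra_simps)
    then show ?thesis
      unfolding e1 e2 e3 power_int_add[OF disjI1[OF q_nonzero], of _ "2 * r + 1"]
      using q_powi_odd_neq_1[of r] by blast
  qed
  then have "2 * moment 0 1
      = \<kappa> * (\<Sum>\<^sub>\<infinity>r. q powi (5 * tri r + int 4 * r) + q powi (5 * tri (- r - 1) + int 4 * (- r - 1)))"
    unfolding two_moment_1[OF bailey_pair_1'] by simp
  also have "\<dots> = 2 * (\<kappa> * (\<Sum>\<^sub>\<infinity>r. q powi (5 * tri r + int 4 * r)))"
    unfolding two_infsum_int_reflect[OF has_sum_imp_summable[OF theta5_has_sum], symmetric] by simp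
  also have "\<dots> = 2 * value_R"
    unfolding infsumI[OF theta5_has_sum] value_R_def by (simp add: power_diff[symmetric] mult_ac)
  finally show ?thesis by simp
qed

text \<open>Here the averaged numerator is \<open>X (1 - u)\<close> and the denominator cancels
  outright. The first factor of \<open>(-1;q^5)_inf\<close> is 2, matching the 2 on the
  left.\<close>

lemma two_moment_1_1: "2 * moment 1 1
  = \<kappa> * (qpoch_inf (- (q ^ 5)) (q ^ 5) * qpoch_inf (- 1) (q ^ 5) * qpoch_inf (q ^ 5) (q ^ 5))"
proof -
  have "(q powi (5 * tri r + (2 + 3) * r) - q powi (5 * tri r + (9 - 2) * r + 3 - 2)) / (1 - q powi (2 * r + 1))
     = q powi (5 * tri r + int 5 * r)" for r
  proof -
    have e2: "5 * tri r + (9 - 2) * r + 3 - 2 = (5 * tri r + int 5 * r) + (2 * r + 1)"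
      by simp
    have e3: "5 * tri r + (2 + 3) * r = 5 * tri r + int 5 * r" by simp
    have "(X - X * u) / (1 - u) = X" if "u \<noteq> 1" for X u :: complex
      using that by (simp add: divide_simps) (simp add: algebra_simps)
    then show ?thesis
      unfolding e2 e3 power_int_add[OF disjI1[OF q_nonzero], of _ "2 * r + 1"]
      using q_powi_odd_neq_1[of r] by blast
  qed
  then have "2 * moment 1 1 = \<kappa> * (\<Sum>\<^sub>\<infinity>r. q powi (5 * tri r + int 5 * r))"
    unfolding two_moment_1[OF bailey_pair_1] by simp
  then show ?thesis
    unfolding infsumI[OF theta5_has_sum] by simp
qed

text \<open>Euler's identity at \<open>q^5\<close> and a bisection turn
  \<open>(-q^5;q^5)_inf\<close> into the reciprocal of \<open>(q^5,q^15;q^20)_inf\<close>, and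
  \<open>\<kappa>\<close> is the reciprocal of \<open>(-q;q^2)_inf (q^4;q^4)_inf\<close>.\<close>

lemma moment_1_1: "moment 1 1 = middle_product q"
proof -
  let ?P = "q ^ 5"
  have P: "norm ?P < 1" "norm (?P\<^sup>2) < 1" and q4: "norm (q ^ 4) < 1" and q20: "norm (q ^ 20) < 1"
    using norm_power_q[of 5] norm_power_q[of 10] norm_power_q[of 4] norm_power_q[of 20]
    by (simp_all flip: power_mult)
  have pw: "?P\<^sup>2 = q ^ 10" "(q ^ 10)\<^sup>2
      = q ^ 20" "?P * q ^ 10 = q ^ 15" "(q\<^sup>2)\<^sup>2 = q ^ 4" "q\<^sup>2 * q\<^sup>2 = q ^ 4"
    by (simp_all flip: power_mult power_add power_Suc)
  have "qpoch_inf (- 1) ?P = 2 * qpoch_inf (- ?P) ?P"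
    using qpoch_inf_split[OF P(1), of "- 1" 1] by (simp add: qpoch_def)
  then have m: "moment 1 1 = \<kappa> * qpoch_inf (- ?P) ?P * (qpoch_inf ?P ?P * qpoch_inf (- ?P) ?P)"
    using two_moment_1_1 by (simp add: mult_ac)
  have d: "qpoch_inf ?P ?P * qpoch_inf (- ?P) ?P = qpoch_inf (q ^ 10) (q ^ 10)"
    using qpoch_inf_mult_uminus[OF P(1), of ?P] by (simp only: pw)
  have e: "qpoch_inf (- ?P) ?P * (qpoch_inf (q ^ 5) (q ^ 20) * qpoch_inf (q ^ 15) (q ^ 20)) = 1"
    using euler_odd_distinct[OF P(1)] qpoch_inf_bisect[OF P(2), of ?P] by (simp only: pw)
  have k: "\<kappa> * (qpoch_inf (- q) (q\<^sup>2) * qpoch_inf (q ^ 4) (q ^ 4)) = 1"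
  proof -
    have "qpoch_inf q (q\<^sup>2) * qpoch_inf (- q) (q\<^sup>2) * qpoch_inf (q ^ 4) (q ^ 4) = qpoch_inf (q\<^sup>2) (q\<^sup>2)"
      using qpoch_inf_mult_uminus[OF norm_q2, of q] qpoch_inf_bisect[OF norm_q2, of "q\<^sup>2"] by (simp only: pw)
    then show ?thesis
      using qpoch_inf_self_nonzero[OF norm_q2] unfolding \<kappa>_def by (simp add: mult_ac)
  qed
  have nz: "qpoch_inf (q ^ 20) (q ^ 20) \<noteq> 0"
    by (rule qpoch_inf_self_nonzero[OF q20])
  have "K * E * T = T * Z / (A * (F * (G * Z)) * H)"
    if "E * (F * G) = 1" "K * (A * H) = 1" "Z \<noteq> 0" for K E T Z A F G H :: complex
  proof -
    have "A \<noteq> 0" "F \<noteq> 0" "G \<noteq> 0" "H \<noteq> 0"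
      using that by auto
    moreover have "K * E * T * (A * (F * (G * Z)) * H) = T * Z * ((E * (F * G)) * (K * (A * H)))"
      by (simp add: mult_ac)
    ultimately show ?thesis
      using that by (simp add: eq_divide_eq)
  qed
  from this[OF e k nz] show ?thesis
    unfolding m d middle_product_def qpochs_inf_def by simp
qed

section \<open>The recurrences in \<open>m\<close>\<close>

lemma moment_sums: "(\<lambda>n. weight m n / den n e) sums moment e m"
proof -
  obtain C where C: "0 < C" "\<And>m n. norm (weight m n) \<le> C * norm q ^ n"
    using weight_bound by blast
  obtain K where K: "0 < K" "\<And>n. norm (inverse (qpoch (- q) (q\<^sup>2) n)) \<le> K"
    using inverse_qpoch_bounded[OF norm_q2 uminus_q_mult_neq_1] by blast
  have "norm (q ^ 4) < 1"
    by (rule norm_power_q) simp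
  then obtain L where L: "0 < L" "\<And>n. norm (inverse (qpoch (q ^ 4) (q ^ 4) n)) \<le> L"
    using inverse_qpoch_bounded mult_power_neq_1_complex by metis
  have "summable (\<lambda>n. weight m n / den n e)"
  proof (rule summable_comparison_test')
    show "summable (\<lambda>n. (C * norm q ^ n) * (K * L))"
      using q_less_1 by (intro summable_mult2 summable_mult summable_geometric) simp
    show "norm (weight m n / den n e) \<le> (C * norm q ^ n) * (K * L)" for n
      unfolding divide_inverse inverse_mult_distrib norm_mult
      using C K L by (intro mult_mono) (auto simp: less_imp_le)
  qed
  then show ?thesis
    unfolding moment_def by (rule summable_sums)
qed

text \<open>A shift of \<open>m\<close> multiplies the term by a power of \<open>v = q^(2n)\<close>,
  so linear relations between moments correspond to polynomials in \<open>v\<close>.\<close>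

lemma weight_add: "weight (m + j) n = weight m n * (q ^ (2 * n)) ^ j"
  by (simp add: weight_def power_add power_mult algebra_simps flip: power_mult power_add)

lemma den_1: "den n 1 = (1 + q * q ^ (2 * n)) * den n 0"
  by (simp add: uminus_q_qpoch_Suc)

lemma moment_shift: "moment 1 m + q * moment 1 (m + 1) = moment 0 m"
proof -
  have "weight m n / den n 1 + q * (weight (m + 1) n / den n 1) = weight m n / den n 0" for n
  proof -
    have "weight m n / den n 1 + q * (weight (m + 1) n / den n 1)
        = (1 + q * q ^ (2 * n)) * weight m n / den n 1"
      unfolding weight_add by (simp add: add_divide_distrib algebra_simps)
    also have "\<dots> = weight m n / den n 0"
      unfolding den_1 using den_nonzero[of n 1, unfolded den_1]
      by (intro mult_divide_mult_cancel_left) (metis mult_zero_left)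
    finally show ?thesis .
  qed
  then have "(\<lambda>n. weight m n / den n 0) sums (moment 1 m + q * moment 1 (m + 1))"
    using sums_add[OF moment_sums[of m 1] sums_mult[OF moment_sums[of "m + 1" 1], of q]] by simp
  then show ?thesis
    using moment_sums sums_unique2 by blast
qed

text \<open>The left side belongs to \<open>1 + q v - v^2 - q v^3 = (1 + q v)(1 - v^2)\<close> with
  \<open>v = q^(2n)\<close>, the quotient of \<open>den n 1\<close> by \<open>den (n - 1) 1\<close>.
  It lowers the denominator by one step, and the ratio of consecutive weights expresses the result
  by the moments at \<open>m + 1\<close> and \<open>m + 2\<close>.\<close>

lemma moment_recurrence:
  "moment 1 m + q * moment 1 (m + 1) - moment 1 (m + 2) - q * moment 1 (m + 3)
    = - (q ^ (2 * m)) * (q * moment 1 (m + 1) - q\<^sup>2 * moment 1 (m + 2))"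
proof -
  let ?t = "\<lambda>m n. weight m n / den n 1"
  let ?U = "\<lambda>n. ?t m n + q * ?t (m + 1) n - ?t (m + 2) n - q * ?t (m + 3) n"
  have U: "?U sums (moment 1 m + q * moment 1 (m + 1) - moment 1 (m + 2) - q * moment 1 (m + 3))"
    by (intro sums_add sums_diff sums_mult moment_sums)
  \<comment> \<open>At \<open>n = 0\<close> the polynomial vanishes because \<open>v = 1\<close>;
    hence the index shift leaves no boundary term.\<close>
  have 0: "?U 0 = 0"
    by (simp add: weight_def)
  have Suc: "?U (Suc n) = - (q ^ (2 * m)) * (q * ?t (m + 1) n - q\<^sup>2 * ?t (m + 2) n)" for n
  proof -
    define v where "v = q ^ (2 * n)"
    have v': "q ^ (2 * Suc n) = q\<^sup>2 * v"
      by (simp add: v_def power2_eq_square)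
    have w: "weight m (Suc n) = - (1 - q * v) * (q * v) * q ^ (2 * m) * weight m n"
    proof -
      have "(Suc n)\<^sup>2 + 2 * m * Suc n = (n\<^sup>2 + 2 * m * n) + (Suc (2 * n) + 2 * m)"
        by (simp add: power2_eq_square)
      then have e1: "q ^ ((Suc n)\<^sup>2 + 2 * m * Suc n) = q ^ (n\<^sup>2 + 2 * m * n) * ((q * v) * q ^ (2 * m))"
        by (simp only: power_add power_Suc v_def)
      have e2: "qpoch q (q\<^sup>2) (Suc n) = qpoch q (q\<^sup>2) n * (1 - q * v)"
        by (simp add: qpoch_Suc v_def power_mult)
      show ?thesis
        unfolding weight_def e1 e2 by (simp add: algebra_simps)
    qed
    have f0: "q ^ (2 * Suc n + 1) = q * (q\<^sup>2 * v)"
      using v' by (simp only: power_add power_one_right mult.commute)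
    have f1: "qpoch (- q) (q\<^sup>2) (Suc n + 1) = (1 + q * (q\<^sup>2 * v)) * qpoch (- q) (q\<^sup>2) (n + 1)"
      using uminus_q_qpoch_Suc[of "Suc n", unfolded f0] by simp
    have "(q ^ 4) ^ n = v\<^sup>2"
      by (simp add: v_def mult.commute flip: power_mult)
    then have f2: "qpoch (q ^ 4) (q ^ 4) (Suc n) = (1 - (q\<^sup>2 * v)\<^sup>2) * qpoch (q ^ 4) (q ^ 4) n"
      by (simp add: qpoch_Suc power_mult_distrib)
    have d: "den (Suc n) 1 = (1 + q * (q\<^sup>2 * v)) * (1 - (q\<^sup>2 * v)\<^sup>2) * den n 1"
      unfolding f1 f2 by (simp only: mult_ac)
    have nz: "(1 + q * (q\<^sup>2 * v)) * (1 - (q\<^sup>2 * v)\<^sup>2) \<noteq> 0"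
      using den_nonzero[of "Suc n" 1] unfolding d by auto
    have "?U (Suc n)
        = (1 + q * (q\<^sup>2 * v) - (q\<^sup>2 * v)\<^sup>2 - q * (q\<^sup>2 * v) ^ 3) * weight m (Suc n) / den (Suc n) 1"
      unfolding weight_add v' by (simp add: algebra_simps add_divide_distrib diff_divide_distrib)
    also have "1 + q * (q\<^sup>2 * v) - (q\<^sup>2 * v)\<^sup>2 - q * (q\<^sup>2 * v) ^ 3
        = (1 + q * (q\<^sup>2 * v)) * (1 - (q\<^sup>2 * v)\<^sup>2)"
      by (simp add: algebra_simps power2_eq_square power3_eq_cube)
    also have "\<dots> * weight m (Suc n) / den (Suc n) 1 = weight m (Suc n) / den n 1"
      unfolding d by (rule mult_divide_mult_cancel_left[OF nz])
    also have "\<dots> = - (q ^ (2 * m)) * (q * ?t (m + 1) n - q\<^sup>2 * ?t (m + 2) n)"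
      unfolding w weight_add v_def[symmetric]
      by (simp add: algebra_simps power2_eq_square add_divide_distrib diff_divide_distrib)
    finally show ?thesis .
  qed
  have "(\<lambda>n. ?U (Suc n)) sums (- (q ^ (2 * m)) * (q * moment 1 (m + 1) - q\<^sup>2 * moment 1 (m + 2)))"
    unfolding Suc by (intro sums_diff sums_mult moment_sums)
  then have "?U sums (- (q ^ (2 * m)) * (q * moment 1 (m + 1) - q\<^sup>2 * moment 1 (m + 2)))"
    by (rule sums_Suc_imp[where f = ?U, OF 0])
  then show ?thesis
    using U sums_unique2 by blast
qed

text \<open>The first two are \<open>moment_shift\<close> at 0 and 1. The third involves
  \<open>moment 1 3\<close>, which the recurrence at \<open>m = 0\<close> supplies.\<close>

lemma moment_initial:
  shows "moment 1 0 = value_P - q * middle_product q"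
    and "q * moment 1 2 = value_R - middle_product q"
    and "moment 0 2 = value_P + 2 * q * middle_product q - q * value_R"
proof -
  show a: "moment 1 0 = value_P - q * middle_product q"
    using moment_shift[of 0] by (simp add: moment_0_0 moment_1_1 eq_diff_eq del: One_nat_def)
  show b: "q * moment 1 2 = value_R - middle_product q"
    using moment_shift[of 1] by (simp add: moment_0_1 moment_1_1 algebra_simps del: One_nat_def)
  have "moment 1 0 + q * middle_product q - moment 1 2 - q * moment 1 3
      = - (q * middle_product q - q * (q * moment 1 2))"
    using moment_recurrence[of 0] by (simp add: moment_1_1 power2_eq_square mult.assoc del: One_nat_def flip: numeral_2_eq_2)
  then have "moment 1 2 + q * moment 1 3 = value_P + 2 * q * middle_product q - q * value_R"
    unfolding a b by (simp add: algebra_simps)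
  then show "moment 0 2 = value_P + 2 * q * middle_product q - q * value_R"
    using moment_shift[of 2] by (simp del: One_nat_def)
qed

text \<open>Let \<open>S\<close> be the shift in \<open>m\<close>, so that \<open>moment 0\<close>
  is \<open>1 + q S\<close> applied to \<open>moment 1\<close>. In \<open>q\<close> times the
  recurrence at \<open>m\<close> plus that at \<open>m + 1\<close>, the \<open>S^2\<close> terms on
  the right cancel and leave \<open>- q^(2m+2) (S - q^2 S^3)\<close>. This is divisible by
  \<open>1 + q S\<close>, so a relation in \<open>moment 0\<close> alone results.\<close>

lemma moment_0_recurrence:
  "moment 0 (m + 3)
      = - (q + q ^ (2 * m + 3)) * moment 0 (m + 2) + (1 + q ^ (2 * m + 2)) * moment 0 (m + 1) + q * moment 0 m"
proof -
  have p: "q ^ (2 * m + 3) = q * q\<^sup>2 * q ^ (2 * m)" "q ^ (2 * m + 2) = q\<^sup>2 * q ^ (2 * m)"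
    "q ^ (2 * (m + 1)) = q\<^sup>2 * q ^ (2 * m)"
    by (simp_all add: power_add power2_eq_square power3_eq_cube)
  have i: "m + 1 + 1
      = m + 2" "m + 1 + 2 = m + 3" "m + 1 + 3 = m + 4" "m + 2 + 1 = m + 3" "m + 3 + 1 = m + 4"
    by simp_all
  \<comment> \<open>\<open>a\<close> to \<open>e\<close> stand for \<open>moment 1\<close> at
    \<open>m\<close> to \<open>m + 4\<close>, and \<open>y\<close> for
    \<open>q ^ (2 * m)\<close>.\<close>
  have "d + q * e = - (q + q * (q * q) * y) * (c + q * d) + (1 + q * q * y) * (b + q * c) + q * (a + q * b)"
    if 1: "a + q * b - c - q * d = - y * (q * b - q * q * c)"
      and 2: "b + q * c - d - q * e = - (q * q * y) * (q * c - q * q * d)" for a b c d e y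
  proof -
    have "d + q * e - (- (q + q * (q * q) * y) * (c + q * d) + (1 + q * q * y) * (b + q * c) + q * (a + q * b))
       = - q * (a + q * b - c - q * d - - y * (q * b - q * q * c))
         - (b + q * c - d - q * e - - (q * q * y) * (q * c - q * q * d))"
      by (simp add: algebra_simps)
    then show ?thesis
      unfolding 1 2 by simp
  qed
  from this[OF moment_recurrence[of m, unfolded power2_eq_square] moment_recurrence[of "m + 1", unfolded p i power2_eq_square]]
  show ?thesis
    unfolding moment_shift[symmetric] p i power2_eq_square .
qed

text \<open>The factor \<open>(- q) ^ m\<close> normalises the leading coefficient
  \<open>- q\<close> of the recurrence; its inverse is the prefactor \<open>(-1)^m q^(-m)\<close> of
  the theorem.\<close>

lemma scaled_moment_1_recurrence:
  fixes X :: "nat \<Rightarrow> complex"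
  defines "X m \<equiv> (- q) ^ m * moment 1 m"
  shows "X (m + 3) = (1 + q ^ (2 * m + 2)) * X (m + 2) + (q\<^sup>2 + q ^ (2 * m + 2)) * X (m + 1) - q\<^sup>2 * X m"
proof -
  have p: "(- q) ^ (m + 3)
      = - q * q\<^sup>2 * (- q) ^ m" "(- q) ^ (m + 2) = q\<^sup>2 * (- q) ^ m" "(- q) ^ (m + 1) = - q * (- q) ^ m"
    "q ^ (2 * m + 2) = q\<^sup>2 * q ^ (2 * m)"
    by (simp_all add: power_add power2_eq_square power3_eq_cube)
  have "- q * q\<^sup>2 * s * d
      = (1 + q\<^sup>2 * y) * (q\<^sup>2 * s * c) + (q\<^sup>2 + q\<^sup>2 * y) * (- q * s * b) - q\<^sup>2 * (s * a)"
    if 1: "a + q * b - c - q * d = - y * (q * b - q\<^sup>2 * c)" for a b c d s y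
  proof -
    have "- q * q\<^sup>2 * s * d - ((1 + q\<^sup>2 * y) * (q\<^sup>2 * s * c) + (q\<^sup>2 + q\<^sup>2 * y) * (- q * s * b) - q\<^sup>2 * (s * a))
      = q\<^sup>2 * s * (a + q * b - c - q * d - - y * (q * b - q\<^sup>2 * c))"
      by (simp add: algebra_simps)
    then show ?thesis
      unfolding 1 by simp
  qed
  from this[OF moment_recurrence[of m]] show ?thesis
    unfolding X_def p .
qed

end

section \<open>Uniqueness of solutions and the closed forms\<close>

lemma third_order_recurrence_unique:
  fixes X Y :: "nat \<Rightarrow> 'a :: comm_ring"
  assumes "\<And>m. X (m + 3) = a m * X (m + 2) + b m * X (m + 1) + c m * X m"
    and "\<And>m. Y (m + 3) = a m * Y (m + 2) + b m * Y (m + 1) + c m * Y m"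
    and "X 0 = Y 0" "X 1 = Y 1" "X 2 = Y 2"
  shows "X m = Y m"
proof (induction m rule: less_induct)
  case (less m)
  show ?case
  proof (cases "m < 3")
    case True
    then have "m = 0 \<or> m = 1 \<or> m = 2" by auto
    then show ?thesis using assms(3-5) by auto
  next
    case False
    then obtain k where m: "m = k + 3"
      by (metis add.commute le_Suc_ex not_less)
    then have "X (k + 2) = Y (k + 2)" "X (k + 1) = Y (k + 1)" "X k = Y k"
      by (auto intro!: less)
    then show ?thesis
      unfolding m assms(1,2) by simp
  qed
qed

context nome
begin

lemma value_P_eq: "qpochs_inf [- (q\<^sup>2), - (q ^ 3), q ^ 5] (q ^ 5) * qpoch_inf q (q\<^sup>2) / qpoch_inf (q\<^sup>2) (q\<^sup>2)
    = value_P"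
  by (simp add: value_P_def \<kappa>_def qpochs_inf_def mult_ac)

lemma value_R_eq: "qpochs_inf [- q, - (q ^ 4), q ^ 5] (q ^ 5) * qpoch_inf q (q\<^sup>2) / qpoch_inf (q\<^sup>2) (q\<^sup>2)
    = value_R"
  by (simp add: value_R_def \<kappa>_def qpochs_inf_def mult_ac)

text \<open>The initial values of \<open>A\<close>, \<open>B\<close>, \<open>C\<close> are the
  coordinates of the first three scaled moments: \<open>value_P - q * middle_product q\<close>,
  \<open>- q * middle_product q\<close> and \<open>q * (value_R - middle_product q)\<close>.\<close>

lemma moment_1_closed_form:
  assumes rec: "\<forall>X\<in>{A, B, C}. \<forall>m\<ge>3.
      X m = (1 + q ^ (2 * m - 4)) * X (m - 1) + (q\<^sup>2 + q ^ (2 * m - 4)) * X (m - 2) - q\<^sup>2 * X (m - 3)"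
    and initial: "A 0
        = 1 \<and> A 1 = 0 \<and> A 2 = 0 \<and> B 0 = - q \<and> B 1 = - q \<and> B 2 = - q \<and> C 0 = 0 \<and> C 1 = 0 \<and> C 2 = q"
  shows "(- q) ^ m * moment 1 m = value_P * A m + middle_product q * B m + value_R * C m"
proof (rule third_order_recurrence_unique[where X = "\<lambda>m. (- q) ^ m * moment 1 m"
      and Y = "\<lambda>m. value_P * A m + middle_product q * B m + value_R * C m"
      and a = "\<lambda>m. 1 + q ^ (2 * m + 2)"
      and b = "\<lambda>m. q\<^sup>2 + q ^ (2 * m + 2)" and c = "\<lambda>_. - (q\<^sup>2)"])
  fix m
  show "(- q) ^ (m + 3) * moment 1 (m + 3) = (1 + q ^ (2 * m + 2)) * ((- q) ^ (m + 2) * moment 1 (m + 2))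
      + (q\<^sup>2 + q ^ (2 * m + 2)) * ((- q) ^ (m + 1) * moment 1 (m + 1)) + - (q\<^sup>2) * ((- q) ^ m * moment 1 m)"
    unfolding scaled_moment_1_recurrence by simp
  have "X (m + 3) = (1 + q ^ (2 * m + 2)) * X (m + 2) + (q\<^sup>2 + q ^ (2 * m + 2)) * X (m + 1) - q\<^sup>2 * X m"
    if "X \<in> {A, B, C}" for X
  proof -
    \<comment> \<open>At indices from 3 on the truncated subtractions are exact.\<close>
    have i: "2 * (m + 3) - 4 = 2 * m + 2" "m + 3 - 1 = m + 2" "m + 3 - 2 = m + 1" "m + 3 - 3 = m"
      by simp_all
    show ?thesis
      using rec[rule_format, OF that le_add2[of 3 m], unfolded i] .
  qed
  from this[of A] this[of B] this[of C]
  have "A (m + 3) = (1 + q ^ (2 * m + 2)) * A (m + 2) + (q\<^sup>2 + q ^ (2 * m + 2)) * A (m + 1) - q\<^sup>2 * A m"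
    "B (m + 3) = (1 + q ^ (2 * m + 2)) * B (m + 2) + (q\<^sup>2 + q ^ (2 * m + 2)) * B (m + 1) - q\<^sup>2 * B m"
    "C (m + 3) = (1 + q ^ (2 * m + 2)) * C (m + 2) + (q\<^sup>2 + q ^ (2 * m + 2)) * C (m + 1) - q\<^sup>2 * C m"
    by (simp_all only: insert_iff simp_thms)
  then show "value_P * A (m + 3) + middle_product q * B (m + 3) + value_R * C (m + 3)
      = (1 + q ^ (2 * m + 2)) * (value_P * A (m + 2) + middle_product q * B (m + 2) + value_R * C (m + 2))
      + (q\<^sup>2 + q ^ (2 * m + 2)) * (value_P * A (m + 1) + middle_product q * B (m + 1) + value_R * C (m + 1))
      + - (q\<^sup>2) * (value_P * A m + middle_product q * B m + value_R * C m)"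
    by (simp only:) (simp add: algebra_simps)
next
  show "(- q) ^ 0 * moment 1 0 = value_P * A 0 + middle_product q * B 0 + value_R * C 0"
    by (simp only: initial moment_initial) simp
  show "(- q) ^ 1 * moment 1 1 = value_P * A 1 + middle_product q * B 1 + value_R * C 1"
    by (simp only: initial moment_1_1) simp
  have "(- q) ^ 2 * moment 1 2 = q * (q * moment 1 2)"
    by (simp add: power2_eq_square)
  then show "(- q) ^ 2 * moment 1 2 = value_P * A 2 + middle_product q * B 2 + value_R * C 2"
    by (simp only: initial moment_initial) (simp add: algebra_simps)
qed

text \<open>Again coordinates: \<open>moment 0\<close> starts with \<open>value_P\<close>,
  \<open>value_R\<close> and
  \<open>value_P + 2 * q * middle_product q - q * value_R\<close>.\<close>

lemma moment_0_closed_form: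
  assumes rec: "\<forall>X\<in>{E, F, G}. \<forall>m\<ge>3.
      X m = - (q + q ^ (2 * m - 3)) * X (m - 1) + (1 + q ^ (2 * m - 4)) * X (m - 2) + q * X (m - 3)"
    and initial: "E 0
        = 1 \<and> E 1 = 0 \<and> E 2 = 1 \<and> F 0 = 0 \<and> F 1 = 0 \<and> F 2 = 2 * q \<and> G 0 = 0 \<and> G 1 = 1 \<and> G 2 = - q"
  shows "moment 0 m = value_P * E m + middle_product q * F m + value_R * G m"
proof (rule third_order_recurrence_unique[where X = "moment 0"
      and Y = "\<lambda>m. value_P * E m + middle_product q * F m + value_R * G m"
      and a = "\<lambda>m. - (q + q ^ (2 * m + 3))"
      and b = "\<lambda>m. 1 + q ^ (2 * m + 2)" and c = "\<lambda>_. q"])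
  fix m
  show "moment 0 (m + 3) = - (q + q ^ (2 * m + 3)) * moment 0 (m + 2)
      + (1 + q ^ (2 * m + 2)) * moment 0 (m + 1) + q * moment 0 m"
    by (rule moment_0_recurrence)
  have "X (m + 3) = - (q + q ^ (2 * m + 3)) * X (m + 2) + (1 + q ^ (2 * m + 2)) * X (m + 1) + q * X m"
    if "X \<in> {E, F, G}" for X
  proof -
    have i: "2 * (m + 3) - 4 = 2 * m + 2" "2 * (m + 3) - 3 = 2 * m + 3"
      "m + 3 - 1 = m + 2" "m + 3 - 2 = m + 1" "m + 3 - 3 = m"
      by simp_all
    show ?thesis
      using rec[rule_format, OF that le_add2[of 3 m], unfolded i] .
  qed
  from this[of E] this[of F] this[of G]
  have "E (m + 3) = - (q + q ^ (2 * m + 3)) * E (m + 2) + (1 + q ^ (2 * m + 2)) * E (m + 1) + q * E m"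
    "F (m + 3) = - (q + q ^ (2 * m + 3)) * F (m + 2) + (1 + q ^ (2 * m + 2)) * F (m + 1) + q * F m"
    "G (m + 3) = - (q + q ^ (2 * m + 3)) * G (m + 2) + (1 + q ^ (2 * m + 2)) * G (m + 1) + q * G m"
    by (simp_all only: insert_iff simp_thms)
  then show "value_P * E (m + 3) + middle_product q * F (m + 3) + value_R * G (m + 3)
      = - (q + q ^ (2 * m + 3)) * (value_P * E (m + 2) + middle_product q * F (m + 2) + value_R * G (m + 2))
      + (1 + q ^ (2 * m + 2)) * (value_P * E (m + 1) + middle_product q * F (m + 1) + value_R * G (m + 1))
      + q * (value_P * E m + middle_product q * F m + value_R * G m)"
    by (simp only:) (simp add: algebra_simps)
next
  show "moment 0 0 = value_P * E 0 + middle_product q * F 0 + value_R * G 0"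
    by (simp only: initial moment_0_0) simp
  show "moment 0 1 = value_P * E 1 + middle_product q * F 1 + value_R * G 1"
    by (simp only: initial moment_0_1) simp
  show "moment 0 2 = value_P * E 2 + middle_product q * F 2 + value_R * G 2"
    by (simp only: initial moment_initial) simp
qed

end

theorem theorem3p5:
  fixes q :: complex
  assumes "0 < norm q" and "norm q < 1"
  shows
    "(\<forall>A B C :: nat \<Rightarrow> complex.
        (\<forall>X\<in>{A, B, C}. \<forall>m\<ge>3.
           X m = (1 + q^(2*m-4)) * X (m-1) + (q^2 + q^(2*m-4)) * X (m-2) - q^2 * X (m-3)) \<and>
        A 0 = 1 \<and> A 1 = 0 \<and> A 2 = 0 \<and>
        B 0 = - q \<and> B 1 = - q \<and> B 2 = - q \<and>
        C 0 = 0 \<and> C 1 = 0 \<and> C 2 = q \<longrightarrow>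
        (\<forall>m::nat.
          (\<lambda>n::nat. (-1)^n * qpoch q (q^2) n * q^(n^2 + 2*m*n) /
                    (qpoch (- q) (q^2) (n+1) * qpoch (q^4) (q^4) n))
          sums
          ((-1)^m * q powi (- int m) *
             (qpochs_inf [- (q^2), - (q^3), q^5] (q^5) * qpoch_inf q (q^2)) /
             qpoch_inf (q^2) (q^2) * A m
           + (-1)^m * q powi (- int m) * middle_product q * B m
           + (-1)^m * q powi (- int m) *
             (qpochs_inf [- q, - (q^4), q^5] (q^5) * qpoch_inf q (q^2)) /
             qpoch_inf (q^2) (q^2) * C m)))
     \<and>
     (\<forall>E F G :: nat \<Rightarrow> complex.
        (\<forall>X\<in>{E, F, G}. \<forall>m\<ge>3.
           X m = - (q + q^(2*m-3)) * X (m-1) + (1 + q^(2*m-4)) * X (m-2) + q * X (m-3)) \<and>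
        E 0 = 1 \<and> E 1 = 0 \<and> E 2 = 1 \<and>
        F 0 = 0 \<and> F 1 = 0 \<and> F 2 = 2 * q \<and>
        G 0 = 0 \<and> G 1 = 1 \<and> G 2 = - q \<longrightarrow>
        (\<forall>m::nat.
          (\<lambda>n::nat. (-1)^n * qpoch q (q^2) n * q^(n^2 + 2*m*n) /
                    (qpoch (- q) (q^2) n * qpoch (q^4) (q^4) n))
          sums
          (qpochs_inf [- (q^2), - (q^3), q^5] (q^5) * qpoch_inf q (q^2) /
             qpoch_inf (q^2) (q^2) * E m
           + middle_product q * F m
           + qpochs_inf [- q, - (q^4), q^5] (q^5) * qpoch_inf q (q^2) /
             qpoch_inf (q^2) (q^2) * G m)))"
proof -
  interpret nome q
    using assms by unfold_locales
  show ?thesis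
  proof (rule conjI; intro allI impI)
    fix A B C :: "nat \<Rightarrow> complex" and m :: nat
    assume H: "(\<forall>X\<in>{A, B, C}. \<forall>m\<ge>3.
        X m = (1 + q ^ (2 * m - 4)) * X (m - 1) + (q\<^sup>2 + q ^ (2 * m - 4)) * X (m - 2) - q\<^sup>2 * X (m - 3)) \<and>
        A 0 = 1 \<and> A 1 = 0 \<and> A 2 = 0 \<and> B 0 = - q \<and> B 1 = - q \<and> B 2 = - q \<and> C 0 = 0 \<and> C 1 = 0 \<and> C 2 = q"
    \<comment> \<open>\<open>s\<close> is the inverse of the scaling factor
      \<open>(- q) ^ m\<close>.\<close>
    define s where "s = (- 1) ^ m * q powi (- int m)"
    have "s * (- q) ^ m = 1"
    proof -
      have "s * (- q) ^ m = ((- 1) ^ m * (- 1) ^ m) * (q powi (- int m) * q ^ m)"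
        unfolding s_def power_minus[of q] by (simp only: mult_ac)
      also have "(- 1) ^ m * (- 1) ^ m = (1 :: complex)"
        by (simp flip: power_mult_distrib)
      finally show ?thesis
        by (simp add: power_int_minus)
    qed
    then have "moment 1 m = s * ((- q) ^ m * moment 1 m)"
      by (simp only: mult.assoc[symmetric]) simp
    also have "(- q) ^ m * moment 1 m = value_P * A m + middle_product q * B m + value_R * C m"
      by (rule moment_1_closed_form[OF conjunct1[OF H] conjunct2[OF H]])
    also have "s * \<dots> = s * value_P * A m + s * middle_product q * B m + s * value_R * C m"
      by (simp only: distrib_left mult.assoc)
    finally have closed: "moment 1 m
        = s * value_P * A m + s * middle_product q * B m + s * value_R * C m" .
    have P: "s * (qpochs_inf [- (q\<^sup>2), - (q ^ 3), q ^ 5] (q ^ 5) * qpoch_inf q (q\<^sup>2)) / qpoch_inf (q\<^sup>2) (q\<^sup>2)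
        = s * value_P"
      and R: "s * (qpochs_inf [- q, - (q ^ 4), q ^ 5] (q ^ 5) * qpoch_inf q (q\<^sup>2)) / qpoch_inf (q\<^sup>2) (q\<^sup>2)
          = s * value_R"
      unfolding value_P_eq[symmetric] value_R_eq[symmetric] by (rule times_divide_eq_right[symmetric])+
    show "(\<lambda>n. (- 1) ^ n * qpoch q (q\<^sup>2) n * q ^ (n\<^sup>2 + 2 * m * n)
          / (qpoch (- q) (q\<^sup>2) (n + 1) * qpoch (q ^ 4) (q ^ 4) n)) sums
        ((- 1) ^ m * q powi (- int m) * (qpochs_inf [- (q\<^sup>2), - (q ^ 3), q ^ 5] (q ^ 5) * qpoch_inf q (q\<^sup>2))
            / qpoch_inf (q\<^sup>2) (q\<^sup>2) * A m
          + (- 1) ^ m * q powi (- int m) * middle_product q * B m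
          + (- 1) ^ m * q powi (- int m) * (qpochs_inf [- q, - (q ^ 4), q ^ 5] (q ^ 5) * qpoch_inf q (q\<^sup>2))
            / qpoch_inf (q\<^sup>2) (q\<^sup>2) * C m)"
      using moment_sums[of m 1] unfolding weight_def s_def[symmetric] P R closed .
  next
    fix E F G :: "nat \<Rightarrow> complex" and m :: nat
    assume H: "(\<forall>X\<in>{E, F, G}. \<forall>m\<ge>3.
        X m = - (q + q ^ (2 * m - 3)) * X (m - 1) + (1 + q ^ (2 * m - 4)) * X (m - 2) + q * X (m - 3)) \<and>
        E 0 = 1 \<and> E 1 = 0 \<and> E 2 = 1 \<and> F 0 = 0 \<and> F 1 = 0 \<and> F 2 = 2 * q \<and> G 0 = 0 \<and> G 1 = 1 \<and> G 2 = - q"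
    have "moment 0 m = value_P * E m + middle_product q * F m + value_R * G m"
      by (rule moment_0_closed_form[OF conjunct1[OF H] conjunct2[OF H]])
    note closed = this
    show "(\<lambda>n. (- 1) ^ n * qpoch q (q\<^sup>2) n * q ^ (n\<^sup>2 + 2 * m * n)
          / (qpoch (- q) (q\<^sup>2) n * qpoch (q ^ 4) (q ^ 4) n)) sums
        (qpochs_inf [- (q\<^sup>2), - (q ^ 3), q ^ 5] (q ^ 5) * qpoch_inf q (q\<^sup>2) / qpoch_inf (q\<^sup>2) (q\<^sup>2) * E m
          + middle_product q * F m
          + qpochs_inf [- q, - (q ^ 4), q ^ 5] (q ^ 5) * qpoch_inf q (q\<^sup>2) / qpoch_inf (q\<^sup>2) (q\<^sup>2) * G m)"
      using moment_sums[of m 0] unfolding weight_def value_P_eq value_R_eq closed add_0_right .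
  qed
qed

end
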